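(* For every prime $p\nmid 6$, $$m_3^{(2,2)}(p)-p^3\,m_2^6(p)=-2p^6-2p^4-p^2.$$
   Context: For a prime $p$ and $\ell\ne p$, let $\psi:\mathbb{F}_p\to\mathbb{Q}_\ell(\zeta_p)^\times$ be a nontrivial additive character, $\mathscr L_\psi$ the Artin–Schreier sheaf, and $\mathrm{Kl}_{n+1}=\mathrm{R}^n\pi_!\sigma^*\mathscr L_\psi$ on $\mathbb{G}_{m,\mathbb{F}_p}$, with $\sigma,\pi$ the sum and product of coordinates on $\mathbb{G}_m^{n+1}$. Its Frobenius trace at $a\in\mathbb{F}_p^\times$ is $(-1)^n\sum_{x_i\in\mathbb{F}_p^\times}\psi(x_1+\dots+x_n+\frac{a}{x_1\cdots x_n})$. $m_2^6(p)=\sum_{a\in\mathbb{F}_p^\times}\mathrm{Tr}(\mathrm{Frob}_p\mid(\mathrm{Sym}^6\mathrm{Kl}_2)_{\bar a})$ and $m_3^{(2,2)}(p)=\sum_{a\in\mathbb{F}_p^\times}\mathrm{Tr}(\mathrm{Frob}_p\mid(\mathrm{Kl}_3^{(2,2)})_{\bar a})$. Here $\mathrm{Kl}_3^{(2,2)}$ is the Schur functor of the partition $(4,2)$ applied to $\mathrm{Kl}_3$. Explicitly, $$m_3^{(2,2)}(p)=\sum_{a\in\mathbb{F}_p^\times}\Bigl((s_1^2-s_2)(s_2^2-p^3s_1)-p^3s_1s_2\Bigr),$$ where $s_1=s_1(a)$, $s_2=s_2(a)$ are the elementary symmetric polynomials of degrees 1 and 2 in the three Frobenius eigenvalues of $\mathrm{Kl}_3$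 at $a$ (whose product is $p^3$). *)

theory Defs
  imports
    Complex_Main
    "HOL-Library.Cardinality"
    "HOL-Library.FuncSet"
    "HOL-Library.Multiset"
    "HOL-Computational_Algebra.Formal_Power_Series"
    "HOL-Algebra.Algebraic_Closure_Type"
begin

text \<open>
  Throughout, \<open>'a\<close> is a finite field; in the theorem it has \<open>p\<close> elements and plays the role
  of \<open>F\<^sub>p\<close>. Characters take complex values: all sums below lie in \<open>Q(\<zeta>\<^sub>p)\<close>, which embeds
  both into \<open>Q\<^sub>l(\<zeta>\<^sub>p)\<close> and into the complex numbers.
\<close>

definition additive_character :: "('a::{finite,field} \<Rightarrow> complex) \<Rightarrow> bool" where
  "additive_character \<psi> \<longleftrightarrow> \<psi> 0 = 1 \<and> (\<forall>x y. \<psi> (x + y) = \<psi> x * \<psi> y)"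

definition nontrivial_additive_character :: "('a::{finite,field} \<Rightarrow> complex) \<Rightarrow> bool" where
  "nontrivial_additive_character \<psi> \<longleftrightarrow> additive_character \<psi> \<and> (\<exists>x. \<psi> x \<noteq> 1)"

text \<open>The extension of \<open>'a\<close> of degree \<open>k\<close> inside the algebraic closure, and its trace to \<open>'a\<close>.\<close>

definition ext_field :: "nat \<Rightarrow> 'a::{finite,field} alg_closure set" where
  "ext_field k = {x. x ^ (CARD('a) ^ k) = x}"

definition ext_trace :: "nat \<Rightarrow> 'a::{finite,field} alg_closure \<Rightarrow> 'a" where
  "ext_trace k x = of_ac (\<Sum>i<k. x ^ (CARD('a) ^ i))"

text \<open>
  The trace of the \<open>k\<close>-th power of Frobenius on the stalk of \<open>Kl\<^sub>r\<close> at \<open>a\<close>. By the trace formula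
  it is the signed hyper-Kloosterman sum over the degree \<open>k\<close> extension, formed with the
  character \<open>\<psi> \<circ> Tr\<close>; for \<open>k = 1\<close> and \<open>r = n + 1\<close> it is
  \<open>(-1)^n \<Sum> \<psi> (x\<^sub>1 + \<dots> + x\<^sub>n + a / (x\<^sub>1 \<dots> x\<^sub>n))\<close>.
\<close>

definition Kl_frob_trace :: "('a::{finite,field} \<Rightarrow> complex) \<Rightarrow> nat \<Rightarrow> 'a \<Rightarrow> nat \<Rightarrow> complex" where
  "Kl_frob_trace \<psi> r a k =
     (-1) ^ (r - 1) *
     (\<Sum>x \<in> {1..<r} \<rightarrow>\<^sub>E (ext_field k - {0}).
        \<psi> (ext_trace k ((\<Sum>i\<in>{1..<r}. x i) + to_ac a / (\<Prod>i\<in>{1..<r}. x i))))"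

text \<open>
  The Frobenius eigenvalues of \<open>Kl\<^sub>r\<close> at \<open>a\<close>, with multiplicity. In characteristic zero, the
  eigenvalues of an endomorphism \<open>F\<close> of an \<open>r\<close>-dimensional space are determined by the traces of
  \<open>F, F\<^sup>2, \<dots>, F\<^sup>r\<close>, and conversely any \<open>r\<close> complex numbers are the first \<open>r\<close> power sums of
  a unique multiset of size \<open>r\<close> (Newton), so the description is always uniquely satisfied.
\<close>

definition Kl_frob_eigenvalues :: "('a::{finite,field} \<Rightarrow> complex) \<Rightarrow> nat \<Rightarrow> 'a \<Rightarrow> complex multiset" where
  "Kl_frob_eigenvalues \<psi> r a =
     (THE M. size M = r \<and> (\<forall>k\<in>{1..r}. (\<Sum>\<alpha>\<in>#M. \<alpha> ^ k) = Kl_frob_trace \<psi> r a k))"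

text \<open>
  Elementary and complete homogeneous symmetric polynomials of the members of \<open>M\<close>, through their
  generating functions \<open>\<Prod> (1 + \<alpha> T)\<close> and \<open>\<Prod> 1 / (1 - \<alpha> T)\<close>. If \<open>M\<close> consists of the
  eigenvalues of \<open>F\<close> on \<open>V\<close>, they are the traces of \<open>F\<close> on the \<open>m\<close>-th exterior and symmetric
  powers of \<open>V\<close>.
\<close>

definition elem_sym :: "nat \<Rightarrow> complex multiset \<Rightarrow> complex" where
  "elem_sym m M = fps_nth (\<Prod>\<alpha>\<in>#M. 1 + fps_const \<alpha> * fps_X) m"

definition complete_sym :: "nat \<Rightarrow> complex multiset \<Rightarrow> complex" where
  "complete_sym m M = fps_nth (\<Prod>\<alpha>\<in>#M. inverse (1 - fps_const \<alpha> * fps_X)) m"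

definition moment_2_6 :: "('a::{finite,field} \<Rightarrow> complex) \<Rightarrow> complex" where
  "moment_2_6 \<psi> = (\<Sum>a\<in>UNIV - {0}. complete_sym 6 (Kl_frob_eigenvalues \<psi> 2 a))"

text \<open>
  The summand is the Schur polynomial \<open>s\<^bsub>(4,2)\<^esub>\<close> in the three eigenvalues \<open>\<alpha>, \<beta>, \<gamma>\<close> of
  \<open>Kl\<^sub>3\<close>, written in the elementary symmetric polynomials, with \<open>\<alpha> \<beta> \<gamma> = p\<^sup>3\<close>.
\<close>

definition moment_3_22 :: "('a::{finite,field} \<Rightarrow> complex) \<Rightarrow> complex" where
  "moment_3_22 \<psi> =
     (\<Sum>a\<in>UNIV - {0}.
        let p = of_nat CARD('a);
            s\<^sub>1 = elem_sym 1 (Kl_frob_eigenvalues \<psi> 3 a);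
            s\<^sub>2 = elem_sym 2 (Kl_frob_eigenvalues \<psi> 3 a)
        in (s\<^sub>1\<^sup>2 - s\<^sub>2) * (s\<^sub>2\<^sup>2 - p ^ 3 * s\<^sub>1) - p ^ 3 * s\<^sub>1 * s\<^sub>2)"

end

theory Submission
  imports Defs
begin

text \<open>
  Counting over the split and the nonsplit quadratic algebra together shows that \<open>Kl\<^sub>2\<close> at \<open>a\<close> has
  trace \<open>- K a\<close> and determinant \<open>q\<close>, and that \<open>Kl\<^sub>3\<close> at \<open>a\<close> has \<open>s\<^sub>1 = K3 a\<close> and
  \<open>s\<^sub>2 = q K3 (- a)\<close>, where \<open>K3 (- a)\<close> is the complex conjugate of \<open>K3 a\<close>. The two moments
  become combinations of power sums of \<open>K\<close> and \<open>K3\<close> over \<open>a\<close>.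

  The product formula for \<open>K x * K y\<close> expresses \<open>(K a)\<^sup>3\<close> as the Kloosterman transform of the function
  \<open>n\<close> that counts points on the fibers of the pencil \<open>(x + y + z) (1/x + 1/y + 1/z) = t\<close>. On the other
  side, \<open>K3\<close> is the additive Fourier transform of \<open>u \<mapsto> K (1/u)\<close>, and the additive self-convolution
  of this function is the Kloosterman transform of the shift \<open>n (t + 1)\<close> of the same function.
  By the orthogonality of the kernel \<open>K (v t)\<close>, both the sixth moment of \<open>K\<close> and the fourth moment of
  \<open>K3\<close> reduce to \<open>\<Sum>n\<^sup>2\<close>, which cancels in the difference, and to elementary counts.
\<close>

section \<open>Kloosterman sums over a finite field\<close>

lemma sum_nonzero_scale:
  fixes f :: "'a::{finite,field} \<Rightarrow> complex"
  assumes "c \<noteq> 0"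
  shows "(\<Sum>x\<in>-{0}. f (c * x)) = (\<Sum>x\<in>-{0}. f x)"
  using assms by (intro sum.reindex_bij_witness[of _ "\<lambda>x. x / c" "\<lambda>x. c * x"]) auto

lemma sum_nonzero_divide:
  fixes f :: "'a::{finite,field} \<Rightarrow> complex"
  assumes "c \<noteq> 0"
  shows "(\<Sum>x\<in>-{0}. f (c / x)) = (\<Sum>x\<in>-{0}. f x)"
  using assms by (intro sum.reindex_bij_witness[of _ "\<lambda>x. c / x" "\<lambda>x. c / x"]) auto

lemma sum_scale:
  fixes f :: "'a::{finite,field} \<Rightarrow> complex"
  assumes "c \<noteq> 0"
  shows "(\<Sum>x\<in>UNIV. f (c * x)) = (\<Sum>x\<in>UNIV. f x)"
  using assms by (intro sum.reindex_bij_witness[of _ "\<lambda>x. x / c" "\<lambda>x. c * x"]) auto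

lemma sum_translate:
  fixes f :: "'a::{finite,field} \<Rightarrow> complex"
  shows "(\<Sum>x\<in>UNIV. f (x + c)) = (\<Sum>x\<in>UNIV. f x)"
  by (intro sum.reindex_bij_witness[of _ "\<lambda>x. x - c" "\<lambda>x. x + c"]) auto

lemma sum_nonzero:
  fixes f :: "'a::{finite,zero} \<Rightarrow> complex"
  shows "(\<Sum>x\<in>-{0}. f x) = (\<Sum>x\<in>UNIV. f x) - f 0"
  by (simp add: Compl_eq_Diff_UNIV sum_diff1)

lemma sum_indicator:
  fixes c :: complex
  assumes "finite A"
  shows "(\<Sum>x\<in>A. if P x then c else 0) = c * of_nat (card {x\<in>A. P x})"
  using assms by (simp add: sum.inter_filter[symmetric])

lemma card_nonzero: "card (-{0::'a::{finite,zero}}) = CARD('a) - 1"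
  by (simp add: Compl_eq_Diff_UNIV card_Diff_singleton)

lemma of_nat_card_nonzero:
  "of_nat (card (-{0::'a::{finite,zero}})) = (of_nat CARD('a) - 1 :: complex)"
  by (simp add: card_nonzero of_nat_diff Suc_le_eq)

section \<open>Kloosterman sums: orthogonality and product formula\<close>

definition kl2 :: "('a::{finite,field} \<Rightarrow> complex) \<Rightarrow> 'a \<Rightarrow> complex" where
  "kl2 \<psi> m = (\<Sum>u\<in>-{0}. \<psi> (u + m / u))"

text \<open>Neither sum carries a sign: for nonzero \<open>a\<close>, the Frobenius trace of Kl_2 is
  \<open>- kl2 \<psi> a\<close> and that of Kl_3 is \<open>kl3 \<psi> a\<close>. Both sums also make
  sense at 0, where their values -1 and 1 produce the boundary terms of the later formulas.\<close>

definition kl3 :: "('a::{finite,field} \<Rightarrow> complex) \<Rightarrow> 'a \<Rightarrow> complex" where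
  "kl3 \<psi> a = (\<Sum>x\<in>-{0}. \<Sum>y\<in>-{0}. \<psi> (x + y + a / (x * y)))"

text \<open>Having the field size as a complex number \<open>q\<close> turns all counts into
  polynomial identities in \<open>q\<close>.\<close>

locale nontrivial_character =
  fixes \<psi> :: "'a::{finite,field} \<Rightarrow> complex" and q :: complex
  assumes nontrivial: "nontrivial_additive_character \<psi>"
    and q_eq: "q = of_nat CARD('a)"
begin

abbreviation K :: "'a \<Rightarrow> complex" where "K \<equiv> kl2 \<psi>"
abbreviation K3 :: "'a \<Rightarrow> complex" where "K3 \<equiv> kl3 \<psi>"

lemma psi_0 [simp]: "\<psi> 0 = 1"
  using nontrivial by (simp add: nontrivial_additive_character_def additive_character_def)

lemma psi_add: "\<psi> (x + y) = \<psi> x * \<psi> y"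
  using nontrivial by (simp add: nontrivial_additive_character_def additive_character_def)

lemma sum_psi: "(\<Sum>x\<in>UNIV. \<psi> x) = 0"
proof -
  obtain c where c: "\<psi> c \<noteq> 1"
    using nontrivial by (auto simp: nontrivial_additive_character_def)
  have "(\<Sum>x\<in>UNIV. \<psi> x) = (\<Sum>x\<in>UNIV. \<psi> (x + c))" by (rule sum_translate[symmetric])
  also have "\<dots> = (\<Sum>x\<in>UNIV. \<psi> x) * \<psi> c" by (simp add: psi_add sum_distrib_right)
  finally show ?thesis using c by simp
qed

lemma sum_psi_scale: "(\<Sum>x\<in>UNIV. \<psi> (c * x)) = (if c = 0 then q else 0)"
  using sum_scale[of c \<psi>] sum_psi by (auto simp: q_eq)

lemma sum_nonzero_psi_scale: "(\<Sum>x\<in>-{0}. \<psi> (c * x)) = (if c = 0 then q else 0) - 1"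
  by (simp add: sum_nonzero sum_psi_scale)

lemma sum_nonzero_psi_divide: "(\<Sum>x\<in>-{0}. \<psi> (c / x)) = (if c = 0 then q else 0) - 1"
  using sum_nonzero_divide[of 1 "\<lambda>x. \<psi> (c * x)"] sum_nonzero_psi_scale[of c] by simp

lemma kl2_0 [simp]: "K 0 = -1"
  using sum_nonzero_psi_scale[of 1] by (simp add: kl2_def)

lemma sum_kl2_scale:
  assumes "x \<noteq> 0"
  shows "(\<Sum>m\<in>UNIV. K (m * x)) = 0"
proof -
  have "(\<Sum>m\<in>UNIV. K (m * x)) = (\<Sum>u\<in>-{0}. \<psi> u * (\<Sum>m\<in>UNIV. \<psi> ((x / u) * m)))"
    unfolding kl2_def by (subst sum.swap) (simp add: psi_add mult.commute sum_distrib_left)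
  also have "\<dots> = 0"
    using assms by (intro sum.neutral ballI) (subst sum_psi_scale, simp)
  finally show ?thesis .
qed

text \<open>Summing over \<open>m\<close> first leaves only the pairs with
  \<open>x / u + y / v = 0\<close>, that is \<open>v = - (y / x) * u\<close>. What remains is
  \<open>q\<close> times the sum of \<open>\<psi> ((1 - y / x) * u)\<close> over nonzero
  \<open>u\<close>, which is \<open>q - 1\<close> or -1.\<close>

lemma kl2_orthogonality:
  assumes "x \<noteq> 0" "y \<noteq> 0"
  shows "(\<Sum>m\<in>UNIV. K (m * x) * K (m * y)) = (if x = y then q\<^sup>2 else 0) - q"
proof -
  have "(\<Sum>m\<in>UNIV. K (m * x) * K (m * y))
      = (\<Sum>m\<in>UNIV. \<Sum>u\<in>-{0}. \<Sum>v\<in>-{0}. \<psi> (u + v) * \<psi> ((x / u + y / v) * m))"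
    unfolding kl2_def sum_product by (simp add: psi_add[symmetric] algebra_simps)
  also have "\<dots> = (\<Sum>u\<in>-{0}. \<Sum>v\<in>-{0}. \<psi> (u + v) * (\<Sum>m\<in>UNIV. \<psi> ((x / u + y / v) * m)))"
    by (subst sum.swap, rule sum.cong[OF refl], subst sum.swap) (simp add: sum_distrib_left)
  also have "\<dots> = (\<Sum>u\<in>-{0}. \<Sum>v\<in>-{0}. if v = - (y / x) * u then q * \<psi> ((1 - y / x) * u) else 0)"
  proof (intro sum.cong refl)
    fix u v :: 'a assume "u \<in> -{0}" "v \<in> -{0}"
    then have "x / u + y / v = 0 \<longleftrightarrow> v = - (y / x) * u"
      using assms by (auto simp: field_simps eq_neg_iff_add_eq_0)
    moreover have "u + - (y / x) * u = (1 - y / x) * u" by (simp add: algebra_simps)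
    ultimately show "\<psi> (u + v) * (\<Sum>m\<in>UNIV. \<psi> ((x / u + y / v) * m))
        = (if v = - (y / x) * u then q * \<psi> ((1 - y / x) * u) else 0)"
      by (auto simp: sum_psi_scale)
  qed
  also have "\<dots> = (\<Sum>u\<in>-{0}. q * \<psi> ((1 - y / x) * u))"
    using assms by (intro sum.cong refl) (simp add: sum.delta)
  also have "\<dots> = (if x = y then q\<^sup>2 else 0) - q"
    using assms by (simp add: sum_distrib_left[symmetric] sum_nonzero_psi_scale power2_eq_square
        right_diff_distrib)
  finally show ?thesis .
qed

text \<open>Put \<open>v = u * t\<close> in the double sum. For fixed \<open>t\<close>, scaling
  \<open>u\<close> by \<open>1 + t\<close> gives a single Kloosterman sum. At \<open>t = -1\<close>
  this scaling is impossible: the inner sum is that of \<open>\<psi> ((x - y) / u)\<close>, which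
  differs from \<open>K 0 = -1\<close> by \<open>q\<close> exactly when
  \<open>x = y\<close>.\<close>

lemma kl2_mult:
  "K x * K y = (\<Sum>t\<in>-{0}. K ((1 + t) * (x + y / t))) + (if x = y then q else 0)"
proof -
  have inner: "(\<Sum>u\<in>-{0}. \<psi> (u * (1 + t) + (x + y / t) / u))
      = K ((1 + t) * (x + y / t)) + (if t = -1 then (if x = y then q else 0) else 0)"
    if "t \<noteq> 0" for t
  proof (cases "t = -1")
    case True
    then show ?thesis by (simp add: sum_nonzero_psi_divide)
  next
    case False
    then have "1 + t \<noteq> 0" by (metis add.inverse_unique)
    from sum_nonzero_scale[OF this, of "\<lambda>u. \<psi> (u + (1 + t) * (x + y / t) / u)"] this False
    show ?thesis by (simp add: kl2_def mult.commute)
  qed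
  have "K x * K y = (\<Sum>u\<in>-{0}. \<Sum>v\<in>-{0}. \<psi> (u + x / u + (v + y / v)))"
    unfolding kl2_def sum_product by (simp add: psi_add)
  also have "\<dots> = (\<Sum>u\<in>-{0}. \<Sum>t\<in>-{0}. \<psi> (u * (1 + t) + (x + y / t) / u))"
  proof (rule sum.cong[OF refl])
    fix u :: 'a assume u: "u \<in> -{0}"
    have "(\<Sum>v\<in>-{0}. \<psi> (u + x / u + (v + y / v))) = (\<Sum>t\<in>-{0}. \<psi> (u + x / u + (u * t + y / (u * t))))"
      using u by (intro sum_nonzero_scale[symmetric]) auto
    then show "(\<Sum>v\<in>-{0}. \<psi> (u + x / u + (v + y / v)))
        = (\<Sum>t\<in>-{0}. \<psi> (u * (1 + t) + (x + y / t) / u))"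
      using u by (simp add: algebra_simps add_divide_distrib)
  qed
  also have "\<dots> = (\<Sum>t\<in>-{0}. K ((1 + t) * (x + y / t))
        + (if t = -1 then (if x = y then q else 0) else 0))"
    by (subst sum.swap) (simp add: inner)
  finally show ?thesis by (simp add: sum.distrib sum.delta)
qed

text \<open>Up to a rank one defect caused by \<open>m = 0\<close>, the kernel \<open>K (v t)\<close> is \<open>q\<close> times an orthogonal
  matrix, so it carries second moments to second moments.\<close>

lemma kl2_parseval:
  "(\<Sum>v\<in>-{0}. (\<Sum>t\<in>-{0}. K (v * t) * f t) * (\<Sum>t\<in>-{0}. K (v * t) * g t))
    = q\<^sup>2 * (\<Sum>t\<in>-{0}. f t * g t) - (q + 1) * (\<Sum>t\<in>-{0}. f t) * (\<Sum>t\<in>-{0}. g t)"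
proof -
  define T where "T v = (\<Sum>t\<in>-{0}. K (v * t) * f t) * (\<Sum>t\<in>-{0}. K (v * t) * g t)" for v
  have "(\<Sum>v\<in>UNIV. T v)
      = (\<Sum>v\<in>UNIV. \<Sum>s\<in>-{0}. \<Sum>t\<in>-{0}. (f s * g t) * (K (v * s) * K (v * t)))"
    unfolding T_def sum_product by (simp add: mult_ac)
  also have "\<dots> = (\<Sum>s\<in>-{0}. \<Sum>t\<in>-{0}. (f s * g t) * (\<Sum>v\<in>UNIV. K (v * s) * K (v * t)))"
    by (subst sum.swap, rule sum.cong[OF refl], subst sum.swap) (simp add: sum_distrib_left)
  also have "\<dots> = (\<Sum>s\<in>-{0}. \<Sum>t\<in>-{0}. (if t = s then q\<^sup>2 * (f s * g s) else 0) - q * (f s * g t))"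
    by (intro sum.cong refl, subst kl2_orthogonality) (auto simp: right_diff_distrib mult_ac)
  also have "\<dots> = q\<^sup>2 * (\<Sum>s\<in>-{0}. f s * g s) - q * ((\<Sum>t\<in>-{0}. f t) * (\<Sum>t\<in>-{0}. g t))"
    unfolding sum_product by (simp add: sum_subtractf sum_distrib_left)
  finally have "(\<Sum>v\<in>UNIV. T v) = \<dots>" .
  \<comment> \<open>The row \<open>v = 0\<close> of the kernel is constantly -1. Taking it out of
    the full sum changes the factor \<open>q\<close> into \<open>q + 1\<close>.\<close>
  moreover have "T 0 = (\<Sum>t\<in>-{0}. f t) * (\<Sum>t\<in>-{0}. g t)"
    by (simp add: T_def sum_negf)
  ultimately have "(\<Sum>v\<in>-{0}. T v)
      = q\<^sup>2 * (\<Sum>t\<in>-{0}. f t * g t) - (q + 1) * (\<Sum>t\<in>-{0}. f t) * (\<Sum>t\<in>-{0}. g t)"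
    by (simp add: sum_nonzero[of T] algebra_simps)
  then show ?thesis by (simp add: T_def)
qed

end

lemma sum_sum_indicator:
  fixes F :: "'a::finite \<Rightarrow> complex"
  assumes "finite A"
  shows "(\<Sum>t\<in>UNIV. (\<Sum>x\<in>A. if h x = t then 1 else 0) * F t) = (\<Sum>x\<in>A. F (h x))"
proof -
  have "(\<Sum>t\<in>UNIV. (\<Sum>x\<in>A. if h x = t then 1 else 0) * F t)
      = (\<Sum>x\<in>A. \<Sum>t\<in>UNIV. if t = h x then F t else 0)"
    unfolding sum_distrib_right by (subst sum.swap) (intro sum.cong refl, auto)
  then show ?thesis by simp
qed

section \<open>Moments of Kloosterman transforms\<close>

context nontrivial_character
begin

text \<open>For \<open>v \<noteq> 0\<close> a full row of the kernel sums to 0 and its entry at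
  \<open>t = 0\<close> is -1, so the entries at nonzero \<open>t\<close> sum to 1. Additive
  constants can therefore be moved into the transformed function, and \<open>f 0\<close> acts as the
  constant \<open>- f 0\<close>.\<close>

lemma sum_with_constant:
  assumes "v \<noteq> 0"
  shows "(\<Sum>t\<in>UNIV. K (v * t) * f t) + c = (\<Sum>t\<in>-{0}. K (v * t) * (f t - f 0 + c))"
proof -
  have "(\<Sum>t\<in>-{0}. K (v * t)) = 1"
    using sum_kl2_scale[OF assms] by (simp add: sum_nonzero mult.commute)
  then have "(\<Sum>t\<in>-{0}. K (v * t) * (f t - f 0 + c)) = (\<Sum>t\<in>-{0}. K (v * t) * f t) - f 0 + c"
    by (simp add: algebra_simps sum.distrib sum_subtractf sum_distrib_left[symmetric])
  then show ?thesis by (simp add: sum_nonzero)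
qed

text \<open>Parseval for \<open>f + d\<close> on nonzero \<open>t\<close>, where \<open>d\<close>
  absorbs both \<open>c\<close> and the value at 0. The result depends on \<open>f\<close> only
  through \<open>f 0\<close>, its sum and its sum of squares.\<close>

lemma second_moment:
  assumes \<Phi>: "\<And>v. v \<noteq> 0 \<Longrightarrow> \<Phi> v = (\<Sum>t\<in>UNIV. K (v * t) * f t) + c"
    and A: "(\<Sum>t\<in>UNIV. f t) = A" and B: "(\<Sum>t\<in>UNIV. (f t)\<^sup>2) = B"
    and d: "d = c - f 0"
  shows "(\<Sum>v\<in>-{0}. (\<Phi> v)\<^sup>2)
    = q\<^sup>2 * (B - (f 0)\<^sup>2 + 2 * d * (A - f 0) + (q - 1) * d\<^sup>2) - (q + 1) * (A - f 0 + (q - 1) * d)\<^sup>2"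
proof -
  have \<Phi>': "\<Phi> v = (\<Sum>t\<in>-{0}. K (v * t) * (f t + d))" if "v \<noteq> 0" for v
  proof -
    have "f t - f 0 + c = f t + d" for t by (simp add: d)
    then show ?thesis by (simp only: \<Phi>[OF that] sum_with_constant[OF that])
  qed
  have "(\<Sum>v\<in>-{0}. (\<Phi> v)\<^sup>2) = (\<Sum>v\<in>-{0}. (\<Sum>t\<in>-{0}. K (v * t) * (f t + d)) * (\<Sum>t\<in>-{0}. K (v * t) * (f t + d)))"
    by (intro sum.cong refl) (simp add: \<Phi>' power2_eq_square)
  also have "\<dots> = q\<^sup>2 * (\<Sum>t\<in>-{0}. (f t + d) * (f t + d)) - (q + 1) * (\<Sum>t\<in>-{0}. f t + d) * (\<Sum>t\<in>-{0}. f t + d)"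
    by (rule kl2_parseval)
  also have "(\<Sum>t\<in>-{0}. f t + d) = A - f 0 + (q - 1) * d"
    by (simp add: sum.distrib of_nat_card_nonzero q_eq sum_nonzero[of f] A)
  also have "(\<Sum>t\<in>-{0}. (f t + d) * (f t + d)) = (\<Sum>t\<in>-{0}. (f t)\<^sup>2 + 2 * d * f t + d\<^sup>2)"
    by (simp add: power2_eq_square algebra_simps)
  also have "\<dots> = B - (f 0)\<^sup>2 + 2 * d * (A - f 0) + (q - 1) * d\<^sup>2"
    by (simp add: sum.distrib sum_distrib_left[symmetric] of_nat_card_nonzero q_eq sum_nonzero[of f]
        sum_nonzero[of "\<lambda>t. (f t)\<^sup>2"] A B)
  finally show ?thesis by (simp add: power2_eq_square mult.assoc)
qed

text \<open>Parseval with a point mass at \<open>s\<close> as second function: pairing with one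
  column of the kernel recovers the single value \<open>f s\<close>.\<close>

lemma moment_with_kl2:
  assumes \<Phi>: "\<And>v. v \<noteq> 0 \<Longrightarrow> \<Phi> v = (\<Sum>t\<in>UNIV. K (v * t) * f t) + c"
    and A: "(\<Sum>t\<in>UNIV. f t) = A" and s: "s \<noteq> 0"
    and d: "d = c - f 0"
  shows "(\<Sum>v\<in>-{0}. \<Phi> v * K (v * s)) = q\<^sup>2 * (f s + d) - (q + 1) * (A - f 0 + (q - 1) * d)"
proof -
  have 1: "K (v * s) = (\<Sum>t\<in>-{0}. K (v * t) * (if t = s then 1 else 0))" for v
  proof -
    have "(\<Sum>t\<in>-{0}. K (v * t) * (if t = s then 1 else 0)) = (\<Sum>t\<in>-{0}. if t = s then K (v * t) else 0)"
      by (intro sum.cong) auto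
    then show ?thesis using s by simp
  qed
  have \<Phi>': "\<Phi> v = (\<Sum>t\<in>-{0}. K (v * t) * (f t + d))" if "v \<noteq> 0" for v
  proof -
    have "f t - f 0 + c = f t + d" for t by (simp add: d)
    then show ?thesis by (simp only: \<Phi>[OF that] sum_with_constant[OF that])
  qed
  have "(\<Sum>v\<in>-{0}. \<Phi> v * K (v * s))
      = (\<Sum>v\<in>-{0}. (\<Sum>t\<in>-{0}. K (v * t) * (f t + d)) * (\<Sum>t\<in>-{0}. K (v * t) * (if t = s then 1 else 0)))"
    by (intro sum.cong refl) (simp add: \<Phi>' 1[symmetric])
  also have "\<dots> = q\<^sup>2 * (\<Sum>t\<in>-{0}. (f t + d) * (if t = s then 1 else 0))
      - (q + 1) * (\<Sum>t\<in>-{0}. f t + d) * (\<Sum>t\<in>-{0}. if t = s then 1 else 0)"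
    by (rule kl2_parseval)
  also have "(\<Sum>t\<in>-{0}. f t + d) = A - f 0 + (q - 1) * d"
    by (simp add: sum.distrib of_nat_card_nonzero q_eq sum_nonzero[of f] A)
  also have "(\<Sum>t\<in>-{0}. (f t + d) * (if t = s then 1 else 0)) = (\<Sum>t\<in>-{0}. if t = s then f t + d else 0)"
    by (intro sum.cong) auto
  finally show ?thesis using s by simp
qed

end

section \<open>The pencil \<open>(x + y + z) (1/x + 1/y + 1/z) = t\<close>\<close>

text \<open>The homogeneous pencil of the section title in the chart where the first coordinate is
  1.\<close>

definition pencil :: "'a::field \<Rightarrow> 'a \<Rightarrow> 'a" where
  "pencil y z = (1 + y + z) * (1 + 1 / y + 1 / z)"

definition fiber_count :: "'a::{finite,field} \<Rightarrow> complex" where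
  "fiber_count t = (\<Sum>y\<in>-{0}. \<Sum>z\<in>-{0}. if pencil y z = t then 1 else 0)"

text \<open>Away from characteristic 3 this counts the primitive cube roots of unity in the
  field.\<close>

definition cube_root_count :: "'a::{finite,field} itself \<Rightarrow> complex" where
  "cube_root_count _ = of_nat (card {y :: 'a. y\<^sup>2 + y + 1 = 0})"

lemma sum_fiber_count:
  "(\<Sum>t\<in>UNIV. fiber_count t * F t) = (\<Sum>y\<in>-{0}. \<Sum>z\<in>-{0}. F (pencil y z))"
proof -
  have "(\<Sum>t\<in>UNIV. fiber_count t * F t)
      = (\<Sum>y\<in>-{0}. \<Sum>t\<in>UNIV. (\<Sum>z\<in>-{0}. if pencil y z = t then 1 else 0) * F t)"
    unfolding fiber_count_def by (subst sum.swap) (simp add: sum_distrib_right)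
  then show ?thesis by (simp add: sum_sum_indicator)
qed

lemma sum_fiber_count_total:
  "(\<Sum>t\<in>UNIV. fiber_count (t :: 'a::{finite,field})) = (of_nat CARD('a) - 1)\<^sup>2"
  using sum_fiber_count[of "\<lambda>_ :: 'a. 1"] by (simp add: of_nat_card_nonzero power2_eq_square)

lemma fiber_count_eq_card:
  "fiber_count t = (\<Sum>y\<in>-{0}. of_nat (card {z. z \<noteq> 0 \<and> pencil y z = t}))"
  unfolding fiber_count_def by (subst sum_indicator) simp_all

lemma pencil_minus_1: "z \<noteq> 0 \<Longrightarrow> pencil (-1) z = 1"
  by (simp add: pencil_def)

lemma pencil_eq_0_iff:
  assumes "y \<noteq> 0" "z \<noteq> (0 :: 'a::field)"
  shows "pencil y z = 0 \<longleftrightarrow> 1 + y + z = 0 \<or> (1 + y) * z + y = 0"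
proof -
  have "1 + 1 / y + 1 / z = ((1 + y) * z + y) / (y * z)"
    using assms by (simp add: field_simps)
  then show ?thesis using assms by (simp add: pencil_def)
qed

lemma pencil_eq_1_iff:
  assumes "y \<noteq> 0" "z \<noteq> (0 :: 'a::field)"
  shows "pencil y z = 1 \<longleftrightarrow> y = -1 \<or> z = -1 \<or> z = - y"
proof -
  have "pencil y z - 1 = (y + 1) * (z + 1) * (z + y) / (y * z)"
    using assms by (simp add: pencil_def field_simps)
  then have "pencil y z = 1 \<longleftrightarrow> (y + 1) * (z + 1) * (z + y) = 0"
    using assms by (metis divide_eq_0_iff eq_iff_diff_eq_0 mult_eq_0_iff)
  then show ?thesis by (simp add: eq_neg_iff_add_eq_0)
qed

text \<open>The fiber over 0 is the union of the line \<open>1 + y + z = 0\<close> and the conic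
  \<open>y + z + y * z = 0\<close>. For \<open>y\<close> other than 0 and -1 each of them gives one
  nonzero \<open>z\<close>, and the two coincide exactly when \<open>y\<^sup>2 + y + 1 = 0\<close>.
  For \<open>y = -1\<close> there is no point, since the pencil is constantly 1 there.\<close>

lemma fiber_count_0:
  "fiber_count (0 :: 'a::{finite,field})
    = 2 * (of_nat CARD('a) - 2) - cube_root_count TYPE('a)"
proof -
  have fiber: "of_nat (card {z. z \<noteq> 0 \<and> pencil y z = 0})
      = (2 - (if y = -1 then 2 else 0) - (if y\<^sup>2 + y + 1 = 0 then 1 else 0) :: complex)"
    if y: "y \<noteq> 0" for y :: 'a
  proof (cases "y = -1")
    case True
    then have "{z. z \<noteq> 0 \<and> pencil y z = 0} = {}" by (auto simp: pencil_minus_1)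
    then show ?thesis using True by simp
  next
    case False
    then have y1: "1 + y \<noteq> 0" by (metis add.inverse_unique minus_minus)
    have "z \<noteq> 0 \<and> pencil y z = 0 \<longleftrightarrow> z = -1 - y \<or> z = - y / (1 + y)" for z
    proof -
      have "1 + y + z = 0 \<longleftrightarrow> z = -1 - y" by (auto simp: algebra_simps eq_neg_iff_add_eq_0)
      moreover have "(1 + y) * z + y = 0 \<longleftrightarrow> z = - y / (1 + y)"
        using y1 by (simp only: eq_divide_eq not_False_eq_True if_True eq_neg_iff_add_eq_0 mult.commute[of z])
      moreover have "-1 - y \<noteq> 0" "- y / (1 + y) \<noteq> 0"
        using y y1 by (auto simp: eq_neg_iff_add_eq_0 add.commute)
      ultimately show ?thesis using pencil_eq_0_iff[OF y, of z] by metis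
    qed
    then have "{z. z \<noteq> 0 \<and> pencil y z = 0} = {-1 - y, - y / (1 + y)}" by auto
    moreover have "-1 - y = - y / (1 + y) \<longleftrightarrow> y\<^sup>2 + y + 1 = 0"
    proof -
      have "-1 - y = - y / (1 + y) \<longleftrightarrow> (-1 - y) * (1 + y) + y = 0"
        using y1 by (simp only: eq_divide_eq not_False_eq_True if_True eq_neg_iff_add_eq_0)
      also have "(-1 - y) * (1 + y) + y = - (y\<^sup>2 + y + 1)"
        by (simp add: power2_eq_square algebra_simps)
      finally show ?thesis by (simp only: neg_equal_0_iff_equal)
    qed
    ultimately show ?thesis using False by (auto simp: card_insert_if)
  qed
  have "(\<Sum>y\<in>-{0::'a}. if y\<^sup>2 + y + 1 = 0 then 1 else 0) = cube_root_count TYPE('a)"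
    unfolding cube_root_count_def
    by (subst sum_indicator) (auto intro!: arg_cong[of _ _ card])
  moreover have "(\<Sum>y\<in>-{0::'a}. if y = -1 then 2 else 0 :: complex) = 2"
    by simp
  moreover have "fiber_count (0 :: 'a) = (\<Sum>y\<in>-{0::'a}. 2 - (if y = -1 then 2 else 0) - (if y\<^sup>2 + y + 1 = 0 then 1 else 0))"
    unfolding fiber_count_eq_card by (intro sum.cong refl) (simp add: fiber)
  ultimately have "fiber_count (0 :: 'a) = (\<Sum>y\<in>-{0::'a}. 2) - 2 - cube_root_count TYPE('a)"
    by (simp only: sum_subtractf)
  then show ?thesis by (simp add: of_nat_card_nonzero)
qed

text \<open>The fiber over 1 consists of the lines \<open>y = -1\<close>, \<open>z = -1\<close> and
  \<open>z = - y\<close>, with \<open>q - 1\<close> points each if \<open>q\<close> is the field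
  size. They meet pairwise in three points, which are distinct because 1 and -1 are:
  \<open>3 * (q - 1) - 3\<close>.\<close>

lemma fiber_count_1:
  assumes "(2 :: 'a::{finite,field}) \<noteq> 0"
  shows "fiber_count (1 :: 'a) = 3 * of_nat CARD('a) - 6"
proof -
  have m1: "-1 \<noteq> (1 :: 'a)" using assms by (metis one_add_one add.right_inverse)
  have fiber: "of_nat (card {z. z \<noteq> 0 \<and> pencil y z = 1})
      = (2 + (if y = -1 then of_nat CARD('a) - 3 else 0) - (if y = 1 then 1 else 0) :: complex)"
    if y: "y \<noteq> 0" for y :: 'a
  proof (cases "y = -1")
    case True
    then have "{z. z \<noteq> 0 \<and> pencil y z = 1} = -{0}" by (auto simp: pencil_minus_1)
    then show ?thesis using True m1 by (simp add: of_nat_card_nonzero)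
  next
    case False
    then have "{z. z \<noteq> 0 \<and> pencil y z = 1} = {-1, -y}"
      using y by (auto simp: pencil_eq_1_iff)
    then show ?thesis using False by (auto simp: card_insert_if)
  qed
  have "(\<Sum>y\<in>-{0::'a}. if y = 1 then 1 else 0 :: complex) = 1" by simp
  moreover have "(\<Sum>y\<in>-{0::'a}. if y = -1 then of_nat CARD('a) - 3 else 0 :: complex) = of_nat CARD('a) - 3"
    by simp
  ultimately show ?thesis
    unfolding fiber_count_eq_card
    by (simp add: fiber sum_subtractf sum.distrib of_nat_card_nonzero algebra_simps)
qed

text \<open>The count is 0 or 2, because a root \<open>y\<close> comes with the root
  \<open>-1 - y\<close>, and the discriminant -3 is nonzero. This relation removes the count from
  the final identity.\<close>

lemma cube_root_count_square:
  assumes "(3 :: 'a::{finite,field}) \<noteq> 0"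
  shows "(cube_root_count TYPE('a))\<^sup>2 = 2 * cube_root_count TYPE('a)"
proof (cases "\<exists>y :: 'a. y\<^sup>2 + y + 1 = 0")
  case True
  then obtain y :: 'a where y: "y\<^sup>2 + y + 1 = 0" by blast
  have "z\<^sup>2 + z + 1 = (z - y) * (z - (-1 - y)) + (y\<^sup>2 + y + 1)" for z
    by (simp add: power2_eq_square algebra_simps)
  then have "{y :: 'a. y\<^sup>2 + y + 1 = 0} = {y, -1 - y}" using y by auto
  moreover have "y \<noteq> -1 - y"
  proof
    assume "y = -1 - y"
    then have "2 * y + 1 = 0" by (simp add: algebra_simps)
    moreover have "4 * (y\<^sup>2 + y + 1) = (2 * y + 1)\<^sup>2 + 3"
      by (simp add: power2_eq_square algebra_simps)
    ultimately show False using y assms by simp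
  qed
  ultimately show ?thesis by (simp add: cube_root_count_def)
next
  case False
  then show ?thesis by (simp add: cube_root_count_def)
qed

section \<open>Moments of Kloosterman sums\<close>

text \<open>The left side is the argument that \<open>kl2_mult\<close> produces for the values of
  \<open>K\<close> at \<open>1 + s\<close> and \<open>1 + 1 / s\<close>; this is where the shift of
  the pencil by 1 comes from.\<close>

lemma pencil_shift:
  assumes "s \<noteq> 0" "t \<noteq> (0 :: 'a::field)"
  shows "(1 + t) * ((1 + s) + (1 + 1 / s) / t) = pencil s (s * t) - 1"
  using assms by (simp add: pencil_def field_simps)

text \<open>The left side is the argument that \<open>kl2_mult\<close> produces for the values of
  \<open>K\<close> at \<open>(1 + s) * (1 + 1 / s)\<close> and 1, with the summation variable
  divided by \<open>1 + s\<close>.\<close>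

lemma pencil_twist:
  assumes "1 + s \<noteq> 0" "s \<noteq> 0" "t \<noteq> (0 :: 'a::field)"
  shows "(1 + t / (1 + s)) * ((1 + s) * (1 + 1 / s) + 1 / (t / (1 + s))) = pencil s t"
proof -
  have "(1 + t / (1 + s)) * ((1 + s) * (1 + 1 / s) + 1 / (t / (1 + s)))
      = (1 + s + t) / (1 + s) * ((1 + s) * (1 + 1 / s + 1 / t))"
    using assms by (simp add: add_divide_distrib distrib_left)
  also have "\<dots> = pencil s t" using assms by (simp add: pencil_def)
  finally show ?thesis .
qed

section \<open>Power moments of \<open>K\<close>\<close>

context nontrivial_character
begin

abbreviation (input) n :: "'a \<Rightarrow> complex" where "n \<equiv> fiber_count"

lemma kl2_square:
  "(K a)\<^sup>2 = (\<Sum>t\<in>-{0}. K (a * ((1 + t) * (1 + 1 / t)))) + q"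
  using kl2_mult[of a a] by (simp add: power2_eq_square algebra_simps)

text \<open>Multiply \<open>kl2_square\<close> by \<open>K a\<close> and apply the product formula
  to each summand. The two arguments coincide exactly when \<open>s\<^sup>2 + s + 1 = 0\<close>, and
  each such \<open>s\<close> contributes \<open>q\<close>. At \<open>s = -1\<close> the twist by
  \<open>1 + s\<close> is impossible; the correction \<open>- q * K a\<close> cancels the term
  \<open>q * K a\<close> coming from the square.\<close>

lemma kl2_cube:
  assumes a: "a \<noteq> 0"
  shows "(K a) ^ 3 = (\<Sum>t\<in>UNIV. K (a * t) * n t) + q * cube_root_count TYPE('a)"
proof -
  have summand: "K (a * ((1 + s) * (1 + 1 / s))) * K a
      = (\<Sum>t\<in>-{0}. K (a * pencil s t)) + (if s = -1 then - q * K a else 0)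
        + (if s\<^sup>2 + s + 1 = 0 then q else 0)" if s: "s \<noteq> 0" for s
  proof -
    have root: "a * ((1 + s) * (1 + 1 / s)) = a \<longleftrightarrow> s\<^sup>2 + s + 1 = 0"
    proof -
      have "a * ((1 + s) * (1 + 1 / s)) = a \<longleftrightarrow> (1 + s) * (1 + 1 / s) - 1 = 0" using a by simp
      also have "(1 + s) * (1 + 1 / s) - 1 = (s\<^sup>2 + s + 1) / s"
        using s by (simp add: field_simps power2_eq_square)
      finally show ?thesis using s by simp
    qed
    have "(\<Sum>t\<in>-{0}. K ((1 + t) * (a * ((1 + s) * (1 + 1 / s)) + a / t)))
      = (\<Sum>t\<in>-{0}. K (a * pencil s t)) + (if s = -1 then - q * K a else 0)"
    proof (cases "s = -1")
      case True
      have "(\<Sum>t\<in>-{0}. K ((1 + t) * (a / t))) = (\<Sum>t\<in>-{0}. K (a + a / t))"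
        by (intro sum.cong refl) (simp add: field_simps)
      also have "\<dots> = (\<Sum>t\<in>-{0}. K (a + t))"
        using sum_nonzero_divide[OF a, of "\<lambda>t. K (a + t)"] by simp
      also have "\<dots> = - K a"
        using sum_translate[of K a] sum_kl2_scale[of 1] by (simp add: sum_nonzero add.commute)
      \<comment> \<open>The pencil is constantly 1 on \<open>s = -1\<close>, so the sum on the right
        is \<open>(q - 1) * K a\<close>, while the left side is \<open>- K a\<close>.\<close>
      finally show ?thesis using True
        by (simp add: pencil_minus_1 of_nat_card_nonzero q_eq algebra_simps)
    next
      case False
      then have s1: "1 + s \<noteq> 0" by (metis add.inverse_unique minus_minus)
      have "(\<Sum>t\<in>-{0}. K ((1 + t) * (a * ((1 + s) * (1 + 1 / s)) + a / t)))
        = (\<Sum>t\<in>-{0}. K ((1 + 1 / (1 + s) * t) * (a * ((1 + s) * (1 + 1 / s)) + a / (1 / (1 + s) * t))))"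
        using s1 by (intro sum_nonzero_scale[symmetric]) simp
      also have "\<dots> = (\<Sum>t\<in>-{0}. K (a * pencil s t))"
      proof (intro sum.cong refl arg_cong[of _ _ K])
        fix t :: 'a assume "t \<in> -{0}"
        then have "pencil s t = (1 + t / (1 + s)) * ((1 + s) * (1 + 1 / s) + 1 / (t / (1 + s)))"
          using pencil_twist[OF s1 s] by simp
        moreover have "(1 + b) * (a * c + a / b) = a * ((1 + b) * (c + 1 / b))" for b c
          by (simp add: algebra_simps)
        ultimately show "(1 + 1 / (1 + s) * t) * (a * ((1 + s) * (1 + 1 / s)) + a / (1 / (1 + s) * t))
            = a * pencil s t"
          by (simp only: mult_1 times_divide_eq_left)
      qed
      finally show ?thesis using False by simp
    qed
    then show ?thesis by (subst kl2_mult) (simp only: root)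
  qed
  have e: "(\<Sum>s\<in>-{0::'a}. if s\<^sup>2 + s + 1 = 0 then q else 0) = q * cube_root_count TYPE('a)"
    unfolding cube_root_count_def
    by (subst sum_indicator) (auto intro!: arg_cong[of _ _ card])
  have "(K a) ^ 3 = (\<Sum>s\<in>-{0}. K (a * ((1 + s) * (1 + 1 / s))) * K a) + q * K a"
    by (simp add: power3_eq_cube kl2_square[unfolded power2_eq_square] distrib_right sum_distrib_right)
  also have "\<dots> = (\<Sum>s\<in>-{0}. \<Sum>t\<in>-{0}. K (a * pencil s t)) + q * cube_root_count TYPE('a)"
    by (simp add: summand sum.distrib e)
  also have "(\<Sum>s\<in>-{0}. \<Sum>t\<in>-{0}. K (a * pencil s t)) = (\<Sum>t\<in>UNIV. K (a * t) * n t)"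
    using sum_fiber_count[of "\<lambda>t. K (a * t)"] by (simp add: mult.commute)
  finally show ?thesis .
qed

lemma second_moment_kl2: "(\<Sum>a\<in>-{0}. (K a)\<^sup>2) = q\<^sup>2 - q - 1"
  using kl2_orthogonality[of 1 1] by (simp add: sum_nonzero power2_eq_square)

text \<open>The second moment of the cube, with constant \<open>c = q * e\<close>. The sum
  \<open>Q\<close> stays unevaluated, because the fourth moment of \<open>K3\<close> contains the
  same \<open>Q\<close>.\<close>

lemma sixth_moment_kl2:
  fixes Q e :: complex
  defines "Q \<equiv> \<Sum>t::'a\<in>UNIV. (n t)\<^sup>2" and "e \<equiv> cube_root_count TYPE('a)"
  shows "(\<Sum>a\<in>-{0}. (K a) ^ 6)
    = q\<^sup>2 * (Q - (2 * (q - 2) - e)\<^sup>2 + 2 * (q * e - (2 * (q - 2) - e)) * ((q - 1)\<^sup>2 - (2 * (q - 2) - e))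
          + (q - 1) * (q * e - (2 * (q - 2) - e))\<^sup>2)
      - (q + 1) * ((q - 1)\<^sup>2 - (2 * (q - 2) - e) + (q - 1) * (q * e - (2 * (q - 2) - e)))\<^sup>2"
proof -
  have f0: "n 0 = 2 * (q - 2) - e" by (simp add: fiber_count_0 q_eq e_def)
  have A: "(\<Sum>t\<in>UNIV. n t) = (q - 1)\<^sup>2" by (simp add: sum_fiber_count_total q_eq)
  have "(\<Sum>a\<in>-{0}. (K a) ^ 6) = (\<Sum>a\<in>-{0}. ((K a) ^ 3)\<^sup>2)" by simp
  also have "\<dots> = q\<^sup>2 * (Q - (n 0)\<^sup>2 + 2 * (q * e - n 0) * ((q - 1)\<^sup>2 - n 0)
          + (q - 1) * (q * e - n 0)\<^sup>2)
      - (q + 1) * ((q - 1)\<^sup>2 - n 0 + (q - 1) * (q * e - n 0))\<^sup>2"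
    by (rule second_moment) (simp_all add: kl2_cube A Q_def e_def)
  finally show ?thesis unfolding f0 .
qed

text \<open>The square of \<open>K\<close> is the Kloosterman transform of \<open>r\<close>, the
  fiber count of \<open>h\<close>, plus \<open>q\<close>. Since \<open>h s = h t\<close> only for
  \<open>s = t\<close> or \<open>s = 1 / t\<close>, the fibers have two points except those through
  1 and -1.\<close>

lemma fourth_moment_kl2:
  assumes two: "(2 :: 'a) \<noteq> 0"
  shows "(\<Sum>a\<in>-{0}. (K a) ^ 4) = 2 * q ^ 3 - 3 * q\<^sup>2 - 3 * q - 1"
proof -
  define h where "h t = (1 + t) * (1 + 1 / t)" for t :: 'a
  define r where "r t = (\<Sum>s\<in>-{0}. if h s = t then 1 else 0 :: complex)" for t
  have r: "(\<Sum>t\<in>UNIV. r t * F t) = (\<Sum>s\<in>-{0}. F (h s))" for F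
    unfolding r_def by (rule sum_sum_indicator) simp
  have m1: "-1 \<noteq> (1 :: 'a)" using two by (metis one_add_one add.right_inverse)
  have h_eq: "h s = h t \<longleftrightarrow> s = t \<or> s = 1 / t" if "s \<noteq> 0" "t \<noteq> 0" for s t
  proof -
    have "h s - h t = (s - t) * (s * t - 1) / (s * t)" using that by (simp add: h_def field_simps)
    then have "h s = h t \<longleftrightarrow> (s - t) * (s * t - 1) = 0"
      using that by (metis divide_eq_0_iff eq_iff_diff_eq_0 mult_eq_0_iff)
    then show ?thesis using that by (simp add: eq_divide_eq)
  qed
  have r_h: "r (h t) = 2 - (if t = 1 then 1 else 0) - (if t = -1 then 1 else 0)" if t: "t \<noteq> 0" for t
  proof -
    have "{s \<in> -{0}. h s = h t} = {t, 1 / t}" using t by (auto simp: h_eq)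
    moreover have "t = 1 / t \<longleftrightarrow> t = 1 \<or> t = -1"
      using t by (simp add: eq_divide_eq square_eq_1_iff)
    ultimately show ?thesis unfolding r_def using m1 by (subst sum_indicator) (auto simp: card_insert_if)
  qed
  have r0: "r 0 = 1"
  proof -
    have "h s = (s + 1)\<^sup>2 / s" if "s \<noteq> 0" for s
      using that by (simp add: h_def field_simps power2_eq_square)
    then have "{s \<in> -{0}. h s = 0} = {-1}"
      by (auto simp: eq_neg_iff_add_eq_0)
    then show ?thesis unfolding r_def by (subst sum_indicator) simp_all
  qed
  have A: "(\<Sum>t\<in>UNIV. r t) = q - 1" using r[of "\<lambda>_. 1"] by (simp add: of_nat_card_nonzero q_eq)
  \<comment> \<open>Summing \<open>r\<close> over the points \<open>s\<close> instead of squaring it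
    over the values gives \<open>2 * (q - 1) - 2\<close>.\<close>
  have "(\<Sum>t\<in>UNIV. (r t)\<^sup>2) = (\<Sum>s\<in>-{0}. r (h s))" using r[of r] by (simp add: power2_eq_square)
  also have "\<dots> = 2 * q - 4"
    by (simp add: r_h sum_subtractf of_nat_card_nonzero q_eq)
  finally have B: "(\<Sum>t\<in>UNIV. (r t)\<^sup>2) = 2 * q - 4" .
  have "(\<Sum>a\<in>-{0}. (K a) ^ 4) = (\<Sum>a\<in>-{0}. ((K a)\<^sup>2)\<^sup>2)" by simp
  also have "\<dots> = q\<^sup>2 * (2 * q - 4 - (r 0)\<^sup>2 + 2 * (q - r 0) * (q - 1 - r 0) + (q - 1) * (q - r 0)\<^sup>2)
      - (q + 1) * (q - 1 - r 0 + (q - 1) * (q - r 0))\<^sup>2"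
    using r[of "\<lambda>t. K (a * t)" for a]
    by (intro second_moment A B refl) (simp_all add: kl2_square h_def mult.commute)
  also have "\<dots> = 2 * q ^ 3 - 3 * q\<^sup>2 - 3 * q - 1"
    unfolding r0 by (simp add: power2_eq_square power_numeral_reduce algebra_simps)
  finally show ?thesis .
qed

section \<open>Fourier description of \<open>K3\<close> and its moments\<close>

definition kappa :: "'a \<Rightarrow> complex" where
  "kappa u = (if u = 0 then 0 else K (1 / u))"

definition kappa_conv :: "'a \<Rightarrow> complex" where
  "kappa_conv w = (\<Sum>u\<in>UNIV. kappa u * kappa (w - u))"

text \<open>Replace \<open>y\<close> by \<open>u\<close> with \<open>x * y = 1 / u\<close>: the term
  \<open>a / (x * y)\<close> becomes linear in \<open>u\<close>, and the sum over \<open>x\<close>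
  is \<open>K (1 / u)\<close>. The value 0 of \<open>kappa\<close> at 0 allows \<open>u\<close> to
  range over the whole field.\<close>

lemma kl3_fourier: "K3 a = (\<Sum>u\<in>UNIV. \<psi> (a * u) * kappa u)"
proof -
  have "K3 a = (\<Sum>x\<in>-{0}. \<Sum>u\<in>-{0}. \<psi> (a * u) * \<psi> (x + (1 / u) / x))"
    unfolding kl3_def
  proof (rule sum.cong[OF refl])
    fix x :: 'a assume x: "x \<in> -{0}"
    have "(\<Sum>y\<in>-{0}. \<psi> (x + y + a / (x * y))) = (\<Sum>u\<in>-{0}. \<psi> (x + (1 / x) / u + a / (x * ((1 / x) / u))))"
      using x by (intro sum_nonzero_divide[symmetric]) simp
    then show "(\<Sum>y\<in>-{0}. \<psi> (x + y + a / (x * y))) = (\<Sum>u\<in>-{0}. \<psi> (a * u) * \<psi> (x + (1 / u) / x))"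
      using x by (simp add: psi_add[symmetric] algebra_simps)
  qed
  also have "\<dots> = (\<Sum>u\<in>-{0}. \<psi> (a * u) * K (1 / u))"
    by (subst sum.swap) (simp add: kl2_def sum_distrib_left)
  also have "\<dots> = (\<Sum>u\<in>-{0}. \<psi> (a * u) * kappa u)"
    by (intro sum.cong) (auto simp: kappa_def)
  also have "\<dots> = (\<Sum>u\<in>UNIV. \<psi> (a * u) * kappa u)"
    by (subst sum_nonzero) (simp add: kappa_def)
  finally show ?thesis .
qed

lemma kl3_square_fourier: "(K3 a)\<^sup>2 = (\<Sum>w\<in>UNIV. \<psi> (a * w) * kappa_conv w)"
proof -
  have "(K3 a)\<^sup>2 = (\<Sum>u\<in>UNIV. \<Sum>v\<in>UNIV. \<psi> (a * (v + u)) * (kappa u * kappa v))"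
    unfolding power2_eq_square kl3_fourier sum_product by (simp add: psi_add algebra_simps)
  also have "\<dots> = (\<Sum>u\<in>UNIV. \<Sum>w\<in>UNIV. \<psi> (a * w) * (kappa u * kappa (w - u)))"
    using sum_translate[of "\<lambda>w. \<psi> (a * w) * (kappa u * kappa (w - u))" u for u] by simp
  also have "\<dots> = (\<Sum>w\<in>UNIV. \<psi> (a * w) * kappa_conv w)"
    by (subst sum.swap) (simp add: kappa_conv_def sum_distrib_left)
  finally show ?thesis .
qed

text \<open>The form without complex conjugation, whence the reflected argument of
  \<open>H\<close>.\<close>

lemma fourier_parseval:
  "(\<Sum>a\<in>UNIV. (\<Sum>w\<in>UNIV. \<psi> (a * w) * F w) * (\<Sum>w\<in>UNIV. \<psi> (a * w) * H w))
    = q * (\<Sum>w\<in>UNIV. F w * H (- w))"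
proof -
  have "(\<Sum>a\<in>UNIV. (\<Sum>w\<in>UNIV. \<psi> (a * w) * F w) * (\<Sum>w\<in>UNIV. \<psi> (a * w) * H w))
      = (\<Sum>a\<in>UNIV. \<Sum>v\<in>UNIV. \<Sum>w\<in>UNIV. (F v * H w) * \<psi> ((w + v) * a))"
    unfolding sum_product by (simp add: psi_add algebra_simps)
  also have "\<dots> = (\<Sum>v\<in>UNIV. \<Sum>w\<in>UNIV. (F v * H w) * (\<Sum>a\<in>UNIV. \<psi> ((w + v) * a)))"
    by (subst sum.swap, rule sum.cong[OF refl], subst sum.swap) (simp add: sum_distrib_left)
  also have "\<dots> = (\<Sum>v\<in>UNIV. \<Sum>w\<in>UNIV. if w = - v then q * (F v * H (- v)) else 0)"
  proof (intro sum.cong refl)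
    fix v w :: 'a
    have "w + v = 0 \<longleftrightarrow> w = - v" by (rule eq_neg_iff_add_eq_0[symmetric])
    then show "(F v * H w) * (\<Sum>a\<in>UNIV. \<psi> ((w + v) * a)) = (if w = - v then q * (F v * H (- v)) else 0)"
      by (simp add: sum_psi_scale)
  qed
  finally show ?thesis by (simp add: sum_distrib_left)
qed

text \<open>After inverting \<open>u\<close> this is the orthogonality relation at 1 and -1, which
  are distinct as 2 is nonzero. The full sum is \<open>- q\<close>, and its term at
  \<open>m = 0\<close> is 1.\<close>

lemma kappa_conv_0:
  assumes two: "(2 :: 'a) \<noteq> 0"
  shows "kappa_conv 0 = - q - 1"
proof -
  have m1: "-1 \<noteq> (1 :: 'a)" using two by (metis one_add_one add.right_inverse)
  have "kappa_conv 0 = (\<Sum>u\<in>-{0}. kappa u * kappa (0 - u))"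
    unfolding kappa_conv_def by (subst sum_nonzero) (simp add: kappa_def)
  also have "\<dots> = (\<Sum>u\<in>-{0}. K (1 / u) * K (- (1 / u)))"
    by (intro sum.cong) (auto simp: kappa_def)
  also have "\<dots> = (\<Sum>m\<in>-{0}. K m * K (- m))"
    using sum_nonzero_divide[of 1 "\<lambda>m. K m * K (- m)"] by simp
  also have "\<dots> = - q - 1"
    using kl2_orthogonality[of 1 "-1"] m1 by (subst sum_nonzero) (auto simp: power2_eq_square)
  finally show ?thesis .
qed

text \<open>The substitution \<open>u = w / (1 + s)\<close> turns the convolution into values of \<open>K\<close> along the same
  pencil of elliptic curves that governs \<open>K\<^sup>3\<close>; this links the two moments.\<close>

lemma kappa_conv_nonzero:
  assumes two: "(2 :: 'a) \<noteq> 0" and v: "v \<noteq> 0"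
  shows "kappa_conv (1 / v) = (\<Sum>t\<in>UNIV. K (v * t) * n (t + 1)) + (2 * q - 1)"
proof -
  have m1: "-1 \<noteq> (1 :: 'a)" using two by (metis one_add_one add.right_inverse)
  define S where "S s = (\<Sum>t\<in>-{0}. K (v * (pencil s t - 1)))" for s
  have summand: "K ((1 + s) * v) * K ((1 + 1 / s) * v) = S s + (if s = 1 then q else 0)"
    if s: "s \<noteq> 0" "s \<noteq> -1" for s
  proof -
    have "(1 + s) * v = (1 + 1 / s) * v \<longleftrightarrow> s = 1 \<or> s = -1"
      using s v by (simp add: eq_divide_eq square_eq_1_iff)
    then have eq: "(1 + s) * v = (1 + 1 / s) * v \<longleftrightarrow> s = 1" using s by simp
    have "(\<Sum>t\<in>-{0}. K ((1 + t) * ((1 + s) * v + (1 + 1 / s) * v / t))) = (\<Sum>t\<in>-{0}. K (v * (pencil s (s * t) - 1)))"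
    proof (intro sum.cong refl arg_cong[of _ _ K])
      fix t :: 'a assume "t \<in> -{0}"
      then show "(1 + t) * ((1 + s) * v + (1 + 1 / s) * v / t) = v * (pencil s (s * t) - 1)"
        using pencil_shift[of s t] s by (simp add: algebra_simps flip: pencil_shift)
    qed
    also have "\<dots> = S s" unfolding S_def using s by (intro sum_nonzero_scale)
    finally show ?thesis by (simp only: kl2_mult eq)
  qed
  have aux: "v + b * v = 0 \<longleftrightarrow> b + 1 = 0" for b
  proof -
    have "v + b * v = v * (b + 1)" by (simp add: algebra_simps)
    then show ?thesis using v by simp
  qed
  have "kappa_conv (1 / v) = (\<Sum>u\<in>-{0, 1 / v}. kappa u * kappa (1 / v - u))"
    unfolding kappa_conv_def by (rule sum.mono_neutral_right) (auto simp: kappa_def)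
  also have "\<dots> = (\<Sum>s\<in>-{0, -1}. K ((1 + s) * v) * K ((1 + 1 / s) * v))"
  proof (rule sum.reindex_bij_witness[of _ "\<lambda>s. 1 / (v * (1 + s))" "\<lambda>u. 1 / (v * u) - 1"], goal_cases)
    case (5 u)
    then have "u \<noteq> 0" "1 / v - u \<noteq> 0" by auto
    moreover from this have "1 - v * u \<noteq> 0" using v by (auto simp: field_simps)
    ultimately show ?case using v by (simp add: kappa_def field_simps)
  qed (use v in \<open>auto simp: field_simps eq_neg_iff_add_eq_0 aux\<close>)
  also have "\<dots> = (\<Sum>s\<in>-{0, -1}. S s + (if s = 1 then q else 0))"
    by (intro sum.cong refl) (simp add: summand)
  also have "\<dots> = (\<Sum>s\<in>-{0} - {-1}. S s) + q"
    using m1 by (subst sum.distrib) (auto intro!: arg_cong[of _ _ "sum S"])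
  also have "(\<Sum>s\<in>-{0} - {-1}. S s) = (\<Sum>s\<in>-{0}. S s) - S (-1)"
    by (simp add: sum_diff1)
  \<comment> \<open>The substitution misses \<open>s = -1\<close>, where the pencil is 1 and each of
    the \<open>q - 1\<close> terms is \<open>K 0\<close>. Completing the sum over \<open>s\<close>
    changes the constant \<open>q\<close> into \<open>2 * q - 1\<close>.\<close>
  also have "S (-1) = 1 - q"
    by (simp add: S_def pencil_minus_1 of_nat_card_nonzero q_eq)
  also have "(\<Sum>s\<in>-{0}. S s) = (\<Sum>t\<in>UNIV. n t * K (v * (t - 1)))"
    unfolding S_def by (rule sum_fiber_count[symmetric])
  also have "\<dots> = (\<Sum>t\<in>UNIV. n (t + 1) * K (v * t))"
    using sum_translate[of "\<lambda>t. n t * K (v * (t - 1))" 1] by simp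
  finally show ?thesis by (simp add: mult.commute algebra_simps)
qed

text \<open>Replacing \<open>a\<close> by \<open>- a\<close> reflects the transformed function, so
  Parseval yields the plain sum of squares of \<open>kappa_conv\<close>. The point 0 contributes
  \<open>(q + 1)\<^sup>2\<close>; the rest is a second moment with \<open>f 0 = 3 * q - 6\<close>,
  \<open>c = 2 * q - 1\<close> and hence \<open>d = 5 - q\<close>.\<close>

lemma kl3_mixed_fourth_moment:
  fixes Q :: complex
  assumes two: "(2 :: 'a) \<noteq> 0"
  defines "Q \<equiv> \<Sum>t::'a\<in>UNIV. (n t)\<^sup>2"
  shows "(\<Sum>a\<in>UNIV. (K3 a)\<^sup>2 * (K3 (- a))\<^sup>2)
    = q * ((q + 1)\<^sup>2 + q\<^sup>2 * (Q - (3 * q - 6)\<^sup>2 + 2 * (5 - q) * ((q - 1)\<^sup>2 - (3 * q - 6)) + (q - 1) * (5 - q)\<^sup>2)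
      - (q + 1) * ((q - 1)\<^sup>2 - (3 * q - 6) + (q - 1) * (5 - q))\<^sup>2)"
proof -
  have f0: "n (0 + 1) = 3 * q - 6" using fiber_count_1[OF two] by (simp add: q_eq)
  have A: "(\<Sum>t\<in>UNIV. n (t + 1)) = (q - 1)\<^sup>2"
    by (subst sum_translate) (simp add: sum_fiber_count_total q_eq)
  have B: "(\<Sum>t\<in>UNIV. (n (t + 1))\<^sup>2) = Q"
    unfolding Q_def by (rule sum_translate)
  have "(K3 (- a))\<^sup>2 = (\<Sum>w\<in>UNIV. \<psi> (a * w) * kappa_conv (- w))" for a
    unfolding kl3_square_fourier by (rule sum.reindex_bij_witness[of _ uminus uminus]) auto
  then have "(\<Sum>a\<in>UNIV. (K3 a)\<^sup>2 * (K3 (- a))\<^sup>2) = q * (\<Sum>w\<in>UNIV. kappa_conv w * kappa_conv w)"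
    by (simp add: kl3_square_fourier fourier_parseval)
  also have "(\<Sum>w\<in>UNIV. kappa_conv w * kappa_conv w) = (q + 1)\<^sup>2 + (\<Sum>w\<in>-{0}. (kappa_conv w)\<^sup>2)"
    by (simp add: sum_nonzero kappa_conv_0[OF two] power2_eq_square algebra_simps)
  also have "(\<Sum>w\<in>-{0}. (kappa_conv w)\<^sup>2) = (\<Sum>v\<in>-{0}. (kappa_conv (1 / v))\<^sup>2)"
    using sum_nonzero_divide[of 1 "\<lambda>v. (kappa_conv v)\<^sup>2"] by simp
  also have "\<dots> = q\<^sup>2 * (Q - (n (0 + 1))\<^sup>2 + 2 * (5 - q) * ((q - 1)\<^sup>2 - n (0 + 1)) + (q - 1) * (5 - q)\<^sup>2)
      - (q + 1) * ((q - 1)\<^sup>2 - n (0 + 1) + (q - 1) * (5 - q))\<^sup>2"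
    by (rule second_moment[OF kappa_conv_nonzero[OF two] A B]) (simp_all add: f0[simplified])
  finally show ?thesis unfolding f0 by (simp add: add_diff_eq)
qed

text \<open>Parseval pairs \<open>kappa_conv\<close> with \<open>kappa\<close>, and
  \<open>kappa (- (1 / v)) = K (v * (-1))\<close> is a single column of the kernel. It picks out the
  shifted fiber count at -1, that is \<open>n 0\<close>, through which \<open>e\<close>
  enters.\<close>

lemma kl3_third_moment:
  fixes e :: complex
  assumes two: "(2 :: 'a) \<noteq> 0"
  defines "e \<equiv> cube_root_count TYPE('a)"
  shows "(\<Sum>a\<in>UNIV. (K3 a) ^ 3)
    = q * (q\<^sup>2 * (2 * (q - 2) - e + (5 - q)) - (q + 1) * ((q - 1)\<^sup>2 - (3 * q - 6) + (q - 1) * (5 - q)))"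
proof -
  have f0: "n (0 + 1) = 3 * q - 6" using fiber_count_1[OF two] by (simp add: q_eq)
  have fs: "n (-1 + 1) = 2 * (q - 2) - e" by (simp add: fiber_count_0 q_eq e_def)
  have A: "(\<Sum>t\<in>UNIV. n (t + 1)) = (q - 1)\<^sup>2"
    by (subst sum_translate) (simp add: sum_fiber_count_total q_eq)
  have "(\<Sum>a\<in>UNIV. (K3 a) ^ 3) = (\<Sum>a\<in>UNIV. (K3 a)\<^sup>2 * K3 a)"
    by (simp add: power3_eq_cube power2_eq_square)
  also have "\<dots> = q * (\<Sum>w\<in>UNIV. kappa_conv w * kappa (- w))"
    unfolding kl3_square_fourier unfolding kl3_fourier by (rule fourier_parseval)
  also have "(\<Sum>w\<in>UNIV. kappa_conv w * kappa (- w)) = (\<Sum>w\<in>-{0}. kappa_conv w * kappa (- w))"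
    by (subst sum_nonzero) (simp add: kappa_def)
  also have "\<dots> = (\<Sum>v\<in>-{0}. kappa_conv (1 / v) * kappa (- (1 / v)))"
    using sum_nonzero_divide[of 1 "\<lambda>v. kappa_conv v * kappa (- v)"] by simp
  also have "\<dots> = (\<Sum>v\<in>-{0}. kappa_conv (1 / v) * K (v * (-1)))"
    by (intro sum.cong refl) (simp add: kappa_def)
  also have "\<dots> = q\<^sup>2 * (n (-1 + 1) + (5 - q)) - (q + 1) * ((q - 1)\<^sup>2 - n (0 + 1) + (q - 1) * (5 - q))"
    by (rule moment_with_kl2[OF kappa_conv_nonzero[OF two] A]) (simp_all add: f0[simplified])
  finally show ?thesis unfolding f0 fs .
qed

section \<open>Combining the moments\<close>

lemma kl3_0: "K3 0 = 1"
proof -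
  have "K3 0 = (\<Sum>x\<in>-{0}. \<psi> x) * (\<Sum>y\<in>-{0}. \<psi> y)"
    unfolding kl3_def sum_product by (simp add: psi_add)
  then show ?thesis using sum_nonzero_psi_scale[of 1] by simp
qed

text \<open>The first summand is the Schur polynomial at \<open>s\<^sub>1 = K3 a\<close>,
  \<open>s\<^sub>2 = q * K3 (- a)\<close>; the second is the complete symmetric polynomial of degree
  6 of two numbers with sum \<open>- K a\<close> and product \<open>q\<close>.\<close>

theorem kl3_kl2_moment_identity:
  assumes two: "(2 :: 'a) \<noteq> 0" and three: "(3 :: 'a) \<noteq> 0"
  shows "(\<Sum>a\<in>-{0}. q\<^sup>2 * ((K3 a)\<^sup>2 * (K3 (- a))\<^sup>2) - q ^ 3 * ((K3 a) ^ 3 + (K3 (- a)) ^ 3))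
      - q ^ 3 * (\<Sum>a\<in>-{0}. (K a) ^ 6 - 5 * q * (K a) ^ 4 + 6 * q\<^sup>2 * (K a)\<^sup>2 - q ^ 3)
    = - 2 * q ^ 6 - 2 * q ^ 4 - q\<^sup>2"
proof -
  define Q where "Q = (\<Sum>t::'a\<in>UNIV. (n t)\<^sup>2)"
  define e where "e = cube_root_count TYPE('a)"
  define M T U where "M = (\<Sum>a\<in>UNIV. (K3 a)\<^sup>2 * (K3 (- a))\<^sup>2)"
    and "T = (\<Sum>a\<in>UNIV. (K3 a) ^ 3)" and "U = (\<Sum>a\<in>-{0}. (K a) ^ 6)"
  have M0: "(\<Sum>a\<in>-{0}. (K3 a)\<^sup>2 * (K3 (- a))\<^sup>2) = M - 1"
    by (subst sum_nonzero) (simp add: M_def kl3_0)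
  have T0: "(\<Sum>a\<in>-{0}. (K3 a) ^ 3) = T - 1"
    by (simp add: sum_nonzero T_def kl3_0)
  have T0': "(\<Sum>a\<in>-{0}. (K3 (- a)) ^ 3) = T - 1"
    unfolding T0[symmetric] by (rule sum.reindex_bij_witness[of _ uminus uminus]) auto
  have e: "e\<^sup>2 = 2 * e" unfolding e_def by (rule cube_root_count_square[OF three])
  have "(\<Sum>a\<in>-{0}. q\<^sup>2 * ((K3 a)\<^sup>2 * (K3 (- a))\<^sup>2) - q ^ 3 * ((K3 a) ^ 3 + (K3 (- a)) ^ 3))
      - q ^ 3 * (\<Sum>a\<in>-{0}. (K a) ^ 6 - 5 * q * (K a) ^ 4 + 6 * q\<^sup>2 * (K a)\<^sup>2 - q ^ 3)
    = q\<^sup>2 * (M - 1) - q ^ 3 * (2 * (T - 1))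
      - q ^ 3 * (U - 5 * q * (2 * q ^ 3 - 3 * q\<^sup>2 - 3 * q - 1) + 6 * q\<^sup>2 * (q\<^sup>2 - q - 1) - q ^ 3 * (q - 1))"
    by (simp add: sum.distrib sum_subtractf M0 T0 T0' sum_distrib_left[symmetric] U_def[symmetric]
        fourth_moment_kl2[OF two] second_moment_kl2 of_nat_card_nonzero q_eq[symmetric] algebra_simps)
  \<comment> \<open>Both moments contain \<open>q ^ 5 * Q\<close>, which cancels. The dependence on
    \<open>e\<close> reduces to \<open>e\<^sup>2 - 2 * e\<close>, which is 0.\<close>
  also have "\<dots> = - 2 * q ^ 6 - 2 * q ^ 4 - q\<^sup>2 - q ^ 6 * (e\<^sup>2 - 2 * e)"
    unfolding kl3_mixed_fourth_moment[OF two, folded M_def Q_def]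
      kl3_third_moment[OF two, folded T_def e_def]
      sixth_moment_kl2[folded U_def Q_def e_def]
    by (simp add: power2_eq_square power_numeral_reduce algebra_simps)
  finally show ?thesis using e by simp
qed

end

section \<open>The quadratic extension\<close>

lemma field_power_card: "(x :: 'a::{finite,field}) ^ CARD('a) = x"
proof (cases "x = 0")
  case False
  have "(\<Prod>y\<in>-{0}. x * y) = (\<Prod>y\<in>-{0}. y)"
    using False by (intro prod.reindex_bij_witness[of _ "\<lambda>y. y / x" "\<lambda>y. x * y"]) auto
  then have "x ^ card (-{0 :: 'a}) = 1" by (simp add: prod.distrib)
  then have "x * x ^ (CARD('a) - 1) = x" by (simp add: card_nonzero)
  moreover have "CARD('a) = Suc (CARD('a) - 1)" by (simp add: Suc_leI)
  ultimately show ?thesis by (metis power_Suc)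
qed simp

lemma of_nat_CARD_eq_0: "of_nat CARD('a) = (0 :: 'a::{finite,field})"
proof -
  have "(\<Sum>x\<in>UNIV. x + 1) = (\<Sum>x\<in>UNIV. x :: 'a)"
    by (intro sum.reindex_bij_witness[of _ "\<lambda>x. x - 1" "\<lambda>x. x + 1"]) auto
  then show ?thesis by (simp add: sum.distrib)
qed

lemma CHAR_eq_CARD:
  assumes "prime CARD('a::{finite,field})"
  shows "CHAR('a) = CARD('a)"
proof -
  have "CHAR('a) dvd CARD('a)" using of_nat_CARD_eq_0 of_nat_eq_0_iff_char_dvd by blast
  then show ?thesis using assms CHAR_not_1' by (metis prime_nat_iff One_nat_def)
qed

lemma power_card_add:
  fixes x y :: "'a::{finite,field} alg_closure"
  assumes "prime CARD('a)"
  shows "(x + y) ^ CARD('a) = x ^ CARD('a) + y ^ CARD('a)"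
  using assms by (intro freshmans_dream) (simp_all add: CHAR_eq_CARD)

lemma power_eq_self_roots:
  assumes "1 < m"
  shows "finite {x :: 'b::field. x ^ m = x}" "card {x :: 'b. x ^ m = x} \<le> m"
proof -
  define P :: "'b poly" where "P = Polynomial.monom 1 m + [:0, -1:]"
  have deg: "Polynomial.degree P = m"
    unfolding P_def using assms by (subst degree_add_eq_left) (simp_all add: degree_monom_eq)
  then have "P \<noteq> 0" using assms by auto
  moreover have "{x :: 'b. x ^ m = x} = {x. poly P x = 0}"
    by (auto simp: P_def poly_monom)
  ultimately show "finite {x :: 'b. x ^ m = x}" "card {x :: 'b. x ^ m = x} \<le> m"
    using poly_roots_finite[of P] card_poly_roots_bound[of P] deg by auto
qed

lemma CARD_field_gt_1: "1 < CARD('a::{finite,field})"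
proof -
  have "card {0, 1 :: 'a} \<le> CARD('a)" by (intro card_mono) auto
  then show ?thesis by simp
qed

text \<open>All elements of the base field are fixed, and the polynomial whose roots are the fixed
  points has no room for more.\<close>

lemma power_card_fixed_iff:
  fixes x :: "'a::{finite,field} alg_closure"
  shows "x ^ CARD('a) = x \<longleftrightarrow> x \<in> range to_ac"
proof -
  let ?S = "{x :: 'a alg_closure. x ^ CARD('a) = x}"
  have sub: "range to_ac \<subseteq> ?S" by (auto simp: field_power_card simp flip: to_ac_power)
  have "card (range (to_ac :: 'a \<Rightarrow> _)) = CARD('a)" by (rule card_image[OF inj_to_ac])
  then have "range to_ac = ?S"
    using power_eq_self_roots[OF CARD_field_gt_1[where 'a = 'a], where 'b = "'a alg_closure"] sub
    by (intro card_seteq) auto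
  then show ?thesis by auto
qed

lemma ext_field_1: "ext_field 1 = range (to_ac :: 'a::{finite,field} \<Rightarrow> _)"
  by (auto simp: ext_field_def power_card_fixed_iff)

lemma ext_trace_1: "ext_trace 1 (to_ac x) = x"
  by (simp add: ext_trace_def)

section \<open>Trace and norm of the quadratic extension\<close>

definition ext_norm :: "'a::{finite,field} alg_closure \<Rightarrow> 'a" where
  "ext_norm x = of_ac (x * x ^ CARD('a))"

lemma ext_trace_2: "ext_trace 2 (x :: 'a::{finite,field} alg_closure) = of_ac (x + x ^ CARD('a))"
  by (simp add: ext_trace_def numeral_2_eq_2)

lemma ext_field_2_iff: "(x :: 'a::{finite,field} alg_closure) \<in> ext_field 2 \<longleftrightarrow> (x ^ CARD('a)) ^ CARD('a) = x"
  by (simp add: ext_field_def power2_eq_square power_mult)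

lemma finite_ext_field_2 [simp]: "finite (ext_field 2 :: 'a::{finite,field} alg_closure set)"
proof -
  have "1 < CARD('a) ^ 2" by (rule one_less_power[OF CARD_field_gt_1]) simp
  then show ?thesis unfolding ext_field_def by (rule power_eq_self_roots)
qed

lemma to_ac_power_card: "to_ac (c :: 'a::{finite,field}) ^ CARD('a) = to_ac c"
  by (simp add: power_card_fixed_iff)

text \<open>For a field of prime size the exponent in \<open>frob\<close> is the characteristic
  itself, so additivity is the freshman's dream. The parameter only fixes the type.\<close>

locale prime_card =
  fixes ty :: "'a::{finite,field} itself"
  assumes prime_CARD: "prime CARD('a)"
begin

abbreviation E :: "'a alg_closure set" where "E \<equiv> ext_field 2"
abbreviation tr :: "'a alg_closure \<Rightarrow> 'a" where "tr \<equiv> ext_trace 2"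
abbreviation nm :: "'a alg_closure \<Rightarrow> 'a" where "nm \<equiv> ext_norm"

definition frob :: "'a alg_closure \<Rightarrow> 'a alg_closure" where "frob x = x ^ CARD('a)"

lemma frob_simps [simp]:
  "frob (x + y) = frob x + frob y" "frob (x * y) = frob x * frob y" "frob (x / y) = frob x / frob y"
  "frob (to_ac c) = to_ac c" "frob 0 = 0" "frob 1 = 1" "frob x = 0 \<longleftrightarrow> x = 0"
  using power_card_add[OF prime_CARD, of x y]
  by (simp_all add: frob_def power_mult_distrib power_divide to_ac_power_card)

lemma frob_fixed_iff: "frob x = x \<longleftrightarrow> x \<in> range to_ac"
  by (simp add: frob_def power_card_fixed_iff)

lemma in_E_iff: "x \<in> E \<longleftrightarrow> frob (frob x) = x"
  by (simp add: ext_field_2_iff frob_def)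

text \<open>For \<open>x\<close> in \<open>E\<close>, Frobenius swaps the two summands, so the sum
  lies in the base field and \<open>of_ac\<close> really inverts \<open>to_ac\<close> there.\<close>

lemma to_ac_tr: "x \<in> E \<Longrightarrow> to_ac (tr x) = x + frob x"
  unfolding ext_trace_2 frob_def[symmetric]
  by (intro to_ac_of_ac) (simp add: frob_fixed_iff[symmetric] in_E_iff add.commute)

lemma to_ac_nm: "x \<in> E \<Longrightarrow> to_ac (nm x) = x * frob x"
  unfolding ext_norm_def frob_def[symmetric]
  by (intro to_ac_of_ac) (simp add: frob_fixed_iff[symmetric] in_E_iff mult.commute)

lemma tr_eqI: "x + frob x = to_ac t \<Longrightarrow> tr x = t"
  unfolding ext_trace_2 frob_def[symmetric] by simp

lemma nm_eqI: "x * frob x = to_ac t \<Longrightarrow> nm x = t"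
  unfolding ext_norm_def frob_def[symmetric] by simp

lemma nm_eq_0_iff: "x \<in> E \<Longrightarrow> nm x = 0 \<longleftrightarrow> x = 0"
  by (subst to_ac_eq_0_iff[symmetric], subst to_ac_nm) auto

lemma E_closed:
  "x \<in> E \<Longrightarrow> y \<in> E \<Longrightarrow> x + y \<in> E" "x \<in> E \<Longrightarrow> y \<in> E \<Longrightarrow> x * y \<in> E"
  "x \<in> E \<Longrightarrow> y \<in> E \<Longrightarrow> x / y \<in> E" "to_ac c \<in> E" "x \<in> E \<Longrightarrow> frob x \<in> E" "1 \<in> E"
  by (auto simp: in_E_iff)

text \<open>Let \<open>r\<close> and \<open>r'\<close> be the roots of the quadratic with trace
  \<open>S\<close> and norm \<open>N\<close>. If they lie in the base field, the second set consists
  of their orderings, and the first is empty unless \<open>r = r'\<close>, when it supplies the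
  ordering that is lost. Otherwise Frobenius swaps them, so both lie in the first set and the second
  is empty.\<close>

lemma card_roots:
  assumes N: "N \<noteq> 0"
  shows "card {x \<in> E - {0}. (tr x, nm x) = (S, N)}
    + card {z \<in> (-{0}) \<times> (-{0}). (fst z + snd z, fst z * snd z) = (S, N)} = 2"
    (is "card ?A + card ?B = 2")
proof -
  have "Polynomial.degree [:to_ac N, - to_ac S, 1:] > 0" by simp
  then obtain r where "poly [:to_ac N, - to_ac S, 1:] r = 0" using alg_closed_imp_poly_has_root by blast
  then have root: "to_ac N = r * (to_ac S - r)" by (simp add: algebra_simps)
  define r' where "r' = to_ac S - r"
  have sum: "r + r' = to_ac S" and prod: "r * r' = to_ac N" by (simp_all add: r'_def root)
  have vieta: "x = r \<and> y = r' \<or> x = r' \<and> y = r" if "x + y = to_ac S" "x * y = to_ac N" for x y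
  proof -
    have "(x - r) * (x - r') = x * x - (r + r') * x + r * r'" by (simp add: algebra_simps)
    also have "\<dots> = x * x - (x + y) * x + x * y" by (simp add: sum prod that)
    also have "\<dots> = 0" by (simp add: algebra_simps)
    finally have "x = r \<or> x = r'" by simp
    then show ?thesis using that(1) sum by (metis add.commute add_left_cancel)
  qed
  have A: "?A = {x \<in> E. x + frob x = to_ac S \<and> x * frob x = to_ac N}"
  proof -
    have "tr x = S \<longleftrightarrow> x + frob x = to_ac S" "nm x = N \<longleftrightarrow> x * frob x = to_ac N" if "x \<in> E" for x
      using that by (metis to_ac_eq_iff to_ac_tr, metis to_ac_eq_iff to_ac_nm)
    then show ?thesis using N by auto
  qed
  have B: "(s, t) \<in> ?B \<longleftrightarrow> to_ac s + to_ac t = to_ac S \<and> to_ac s * to_ac t = to_ac N" for s t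
  proof -
    have "s + t = S \<longleftrightarrow> to_ac s + to_ac t = to_ac S" "s * t = N \<longleftrightarrow> to_ac s * to_ac t = to_ac N"
      by (metis to_ac_eq_iff to_ac_add, metis to_ac_eq_iff to_ac_mult)
    then show ?thesis using N by auto
  qed
  show ?thesis
  proof (cases "r \<in> range to_ac")
    case True
    then obtain s where s: "r = to_ac s" by blast
    define s' where "s' = S - s"
    have s': "r' = to_ac s'" by (simp add: r'_def s s'_def)
    have sum': "to_ac s + to_ac s' = to_ac S" and prod': "to_ac s * to_ac s' = to_ac N"
      using sum prod unfolding s s' .
    have "(x, y) \<in> ?B \<longleftrightarrow> (x, y) \<in> {(s, s'), (s', s)}" for x y
    proof
      assume "(x, y) \<in> ?B"
      then have "to_ac x = r \<and> to_ac y = r' \<or> to_ac x = r' \<and> to_ac y = r"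
        unfolding B using vieta by blast
      then show "(x, y) \<in> {(s, s'), (s', s)}" unfolding s s' by simp
    next
      assume "(x, y) \<in> {(s, s'), (s', s)}"
      then have "x = s \<and> y = s' \<or> x = s' \<and> y = s" by simp
      then show "(x, y) \<in> ?B"
        unfolding B using sum' prod' by (metis add.commute mult.commute)
    qed
    then have "\<forall>z. z \<in> ?B \<longleftrightarrow> z \<in> {(s, s'), (s', s)}" unfolding split_paired_All by (intro allI)
    then have "?B = {(s, s'), (s', s)}" by (intro Set.set_eqI) (rule spec)
    moreover have "?A = (if r = r' then {r} else {})"
    proof -
      have "x \<in> ?A \<longleftrightarrow> x = r \<and> r = r'" for x
      proof
        assume "x \<in> ?A"
        then have "x = r \<and> frob x = r' \<or> x = r' \<and> frob x = r"
          unfolding A using vieta[of x "frob x"] by blast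
        moreover have "frob r = r" "frob r' = r'" by (simp_all add: s s')
        ultimately show "x = r \<and> r = r'" by metis
      next
        assume "x = r \<and> r = r'"
        moreover have "frob r = r" "r \<in> E" by (simp_all add: s E_closed)
        ultimately show "x \<in> ?A" unfolding A using sum prod by simp
      qed
      then show ?thesis by auto
    qed
    ultimately show ?thesis using s s' by auto
  next
    case False
    have False': "r' \<notin> range to_ac"
    proof
      assume "r' \<in> range to_ac"
      then obtain t where "r' = to_ac t" by blast
      then have "r = to_ac (S - t)" by (simp add: r'_def algebra_simps)
      then show False using False by blast
    qed
    have frob_sum: "frob r + frob r' = to_ac S" and frob_prod: "frob r * frob r' = to_ac N"
      using arg_cong[OF sum, of frob] arg_cong[OF prod, of frob] by simp_all
    \<comment> \<open>Frobenius permutes the roots, and fixing \<open>r\<close> would place it in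
      the base field.\<close>
    have "frob r \<noteq> r" using False by (simp add: frob_fixed_iff)
    then have c: "frob r = r'" "frob r' = r" using vieta[OF frob_sum frob_prod] by auto
    have "?B = {}"
    proof -
      have "(s, t) \<notin> ?B" for s t
      proof
        assume "(s, t) \<in> ?B"
        then have "to_ac s = r \<or> to_ac s = r'" unfolding B using vieta by blast
        then show False using False False' by blast
      qed
      then have "\<forall>z. z \<notin> ?B" unfolding split_paired_All by (intro allI)
      then have "z \<notin> ?B" for z by (rule spec)
      then show ?thesis by (intro equals0I) (rule notE)
    qed
    moreover have "?A = {r, r'}"
    proof -
      have "x \<in> ?A \<longleftrightarrow> x = r \<or> x = r'" for x
      proof
        assume "x \<in> ?A"
        then show "x = r \<or> x = r'" unfolding A using vieta[of x "frob x"] by auto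
      next
        assume "x = r \<or> x = r'"
        then show "x \<in> ?A"
        proof
          assume "x = r"
          then show ?thesis unfolding A using sum prod c by (simp add: in_E_iff)
        next
          assume "x = r'"
          then show ?thesis unfolding A using sum prod c by (simp add: in_E_iff add.commute mult.commute)
        qed
      qed
      then show ?thesis by auto
    qed
    moreover have "r \<noteq> r'" using c \<open>frob r \<noteq> r\<close> by auto
    ultimately show ?thesis by simp
  qed
qed

text \<open>A monic quadratic polynomial has two (ordered) pairs of conjugate roots in the split and the
  nonsplit quadratic algebra together, whence the factor 2.\<close>

lemma sum_trace_norm:
  fixes \<Phi> :: "'a \<Rightarrow> 'a \<Rightarrow> complex"
  shows "(\<Sum>x\<in>E - {0}. \<Phi> (tr x) (nm x)) + (\<Sum>x\<in>-{0}. \<Sum>y\<in>-{0}. \<Phi> (x + y) (x * y))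
    = 2 * (\<Sum>S\<in>UNIV. \<Sum>N\<in>-{0}. \<Phi> S N)"
proof -
  let ?T = "UNIV \<times> (-{0}) :: ('a \<times> 'a) set"
  let ?A = "\<lambda>z. {x \<in> E - {0}. (tr x, nm x) = z}"
  let ?B = "\<lambda>w. {z \<in> (-{0}) \<times> (-{0} :: 'a set). (fst z + snd z, fst z * snd z) = w}"
  have "(\<Sum>x\<in>E - {0}. \<Phi> (tr x) (nm x)) = (\<Sum>z\<in>?T. \<Sum>x\<in>?A z. \<Phi> (tr x) (nm x))"
    by (rule sum.group[symmetric]) (auto simp: nm_eq_0_iff)
  also have "\<dots> = (\<Sum>z\<in>?T. of_nat (card (?A z)) * \<Phi> (fst z) (snd z))"
  proof (rule sum.cong[OF refl])
    fix z :: "'a \<times> 'a"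
    have "(\<Sum>x\<in>?A z. \<Phi> (tr x) (nm x)) = (\<Sum>x\<in>?A z. \<Phi> (fst z) (snd z))"
      by (rule sum.cong) auto
    then show "(\<Sum>x\<in>?A z. \<Phi> (tr x) (nm x)) = of_nat (card (?A z)) * \<Phi> (fst z) (snd z)" by simp
  qed
  finally have 1: "(\<Sum>x\<in>E - {0}. \<Phi> (tr x) (nm x)) = \<dots>" .
  have "(\<Sum>x\<in>-{0}. \<Sum>y\<in>-{0}. \<Phi> (x + y) (x * y))
      = (\<Sum>z\<in>(-{0}) \<times> (-{0}). \<Phi> (fst z + snd z) (fst z * snd z))"
    by (simp add: sum.cartesian_product case_prod_unfold)
  also have "\<dots> = (\<Sum>w\<in>?T. \<Sum>z\<in>?B w. \<Phi> (fst z + snd z) (fst z * snd z))"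
    by (rule sum.group[symmetric]) auto
  also have "\<dots> = (\<Sum>w\<in>?T. of_nat (card (?B w)) * \<Phi> (fst w) (snd w))"
  proof (rule sum.cong[OF refl])
    fix w :: "'a \<times> 'a"
    have "(\<Sum>z\<in>?B w. \<Phi> (fst z + snd z) (fst z * snd z)) = (\<Sum>z\<in>?B w. \<Phi> (fst w) (snd w))"
      by (rule sum.cong) auto
    then show "(\<Sum>z\<in>?B w. \<Phi> (fst z + snd z) (fst z * snd z)) = of_nat (card (?B w)) * \<Phi> (fst w) (snd w)"
      by simp
  qed
  finally have 2: "(\<Sum>x\<in>-{0}. \<Sum>y\<in>-{0}. \<Phi> (x + y) (x * y)) = \<dots>" .
  have "(\<Sum>z\<in>?T. of_nat (card (?A z)) * \<Phi> (fst z) (snd z)) + (\<Sum>z\<in>?T. of_nat (card (?B z)) * \<Phi> (fst z) (snd z))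
      = (\<Sum>z\<in>?T. 2 * \<Phi> (fst z) (snd z))"
    unfolding sum.distrib[symmetric]
  proof (rule sum.cong[OF refl])
    fix z :: "'a \<times> 'a" assume "z \<in> ?T"
    then obtain S N where z: "z = (S, N)" "N \<noteq> 0" by auto
    have "(of_nat (card (?A z) + card (?B z)) :: complex) = 2" unfolding z(1) card_roots[OF z(2)] by simp
    then show "of_nat (card (?A z)) * \<Phi> (fst z) (snd z) + of_nat (card (?B z)) * \<Phi> (fst z) (snd z)
        = 2 * \<Phi> (fst z) (snd z)" by (simp flip: distrib_right)
  qed
  then show ?thesis unfolding 1 2
    by (simp add: sum.cartesian_product case_prod_unfold sum_distrib_left)
qed

end

section \<open>Kloosterman sums over the quadratic extension\<close>

locale prime_character = nontrivial_character \<psi> q + prime_card "TYPE('a)"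
  for \<psi> :: "'a::{finite,field} \<Rightarrow> complex" and q :: complex
begin

lemma add_same_numerator:
  fixes c x y :: "'b::field"
  assumes "x \<noteq> 0" "y \<noteq> 0"
  shows "c / x + c / y = c * (x + y) / (x * y)"
  using assms by (simp add: field_simps)

lemma mult_one_plus_divide:
  fixes c d n :: "'b::field"
  assumes "n \<noteq> 0"
  shows "n * ((1 + d / n) * (1 + c / n)) = n + (c + d) + c * d / n"
  using assms by (simp add: field_simps)

lemma mult_one_plus_divide_mult:
  fixes d y z :: "'b::field"
  assumes "y \<noteq> 0" "z \<noteq> 0"
  shows "y * (1 + d / (y * z)) = y + d / z" "z * (1 + d / (y * z)) = z + d / y"
  using assms by (simp_all add: distrib_left)

lemma tr_add: "x \<in> E \<Longrightarrow> y \<in> E \<Longrightarrow> tr (x + y) = tr x + tr y"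
  by (rule tr_eqI) (simp add: to_ac_tr algebra_simps)

lemma tr_to_ac: "tr (to_ac s) = 2 * s"
  by (rule tr_eqI) simp

lemma tr_divide:
  assumes "x \<in> E" "x \<noteq> 0"
  shows "tr (to_ac a / x) = a * tr x / nm x"
  using assms add_same_numerator[of x "frob x" "to_ac a"]
  by (intro tr_eqI) (simp add: to_ac_tr to_ac_nm)

lemma nm_divide:
  assumes "x \<in> E" "x \<noteq> 0"
  shows "nm (to_ac a / x) = a\<^sup>2 / nm x"
  using assms by (intro nm_eqI) (simp add: to_ac_nm power2_eq_square)

lemma nm_mult: "x \<in> E \<Longrightarrow> y \<in> E \<Longrightarrow> nm (x * y) = nm x * nm y"
  by (rule nm_eqI) (simp add: to_ac_nm)

lemma nm_div: "x \<in> E \<Longrightarrow> y \<in> E \<Longrightarrow> nm (x / y) = nm x / nm y"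
  by (rule nm_eqI) (simp add: to_ac_nm)

text \<open>Take \<open>\<psi> S\<close> restricted to \<open>N = m\<close> in
  \<open>sum_trace_norm\<close>. The right side vanishes because \<open>\<psi>\<close> sums to 0, so
  the nonsplit sum is the negative of the split one, which is \<open>K m\<close>.\<close>

lemma sum_psi_norm_fiber:
  assumes m: "m \<noteq> 0"
  shows "(\<Sum>y | y \<in> E - {0} \<and> nm y = m. \<psi> (tr y)) = - K m"
proof -
  have eq: "(\<Sum>y\<in>-{0}. if x * y = m then \<psi> (x + y) else 0) = \<psi> (x + m / x)" if "x \<noteq> 0" for x
  proof -
    have "(\<Sum>y\<in>-{0}. if x * y = m then \<psi> (x + y) else 0) = (\<Sum>y\<in>-{0}. if y = m / x then \<psi> (x + y) else 0)"
      using that by (intro sum.cong) (auto simp: eq_divide_eq mult.commute)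
    then show ?thesis using that m by simp
  qed
  have "(\<Sum>x\<in>E - {0}. if nm x = m then \<psi> (tr x) else 0)
      + (\<Sum>x\<in>-{0}. \<Sum>y\<in>-{0}. if x * y = m then \<psi> (x + y) else 0)
      = 2 * (\<Sum>S\<in>UNIV. \<Sum>N\<in>-{0}. if N = m then \<psi> S else 0)"
    by (rule sum_trace_norm)
  also have "\<dots> = 0" using m sum_psi by simp
  also have "(\<Sum>x\<in>-{0}. \<Sum>y\<in>-{0}. if x * y = m then \<psi> (x + y) else 0) = K m"
    by (simp add: eq kl2_def)
  finally show ?thesis
    by (simp add: sum.inter_filter[symmetric] eq_neg_iff_add_eq_0)
qed

text \<open>The same argument with the constant 1 in place of \<open>\<psi>\<close>:
  \<open>2 * q - (q - 1)\<close>.\<close>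

lemma card_norm_fiber:
  assumes m: "m \<noteq> 0"
  shows "of_nat (card {y \<in> E - {0}. nm y = m}) = q + 1"
proof -
  have eq: "(\<Sum>y\<in>-{0}. if x * y = m then 1 else 0 :: complex) = 1" if "x \<noteq> 0" for x
  proof -
    have "(\<Sum>y\<in>-{0}. if x * y = m then 1 else 0 :: complex) = (\<Sum>y\<in>-{0}. if y = m / x then 1 else 0)"
      using that by (intro sum.cong) (auto simp: eq_divide_eq mult.commute)
    then show ?thesis using that m by simp
  qed
  have "(\<Sum>x\<in>E - {0}. if nm x = m then 1 else 0 :: complex)
      + (\<Sum>x\<in>-{0}. \<Sum>y\<in>-{0}. if x * y = m then 1 else 0)
      = 2 * (\<Sum>S::'a\<in>UNIV. \<Sum>N\<in>-{0}. if N = m then 1 else 0)"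
    by (rule sum_trace_norm[where \<Phi> = "\<lambda>S N. if N = m then 1 else 0"])
  also have "\<dots> = 2 * q" using m by (simp add: q_eq)
  also have "(\<Sum>x\<in>-{0}. \<Sum>y\<in>-{0}. if x * y = m then 1 else 0 :: complex) = (\<Sum>x\<in>-{0::'a}. 1)"
    by (intro sum.cong refl eq) simp
  also have "\<dots> = q - 1"
    by (simp add: of_nat_card_nonzero q_eq)
  also have "(\<Sum>x\<in>E - {0}. if nm x = m then 1 else 0 :: complex) = of_nat (card {y \<in> E - {0}. nm y = m})"
    by (subst sum_indicator) simp_all
  finally show ?thesis by (simp add: algebra_simps)
qed

text \<open>The trace of \<open>x + a / x\<close> is \<open>S + a * S / N\<close> in terms of trace
  and norm of \<open>x\<close>. The split counterpart is \<open>(K a)\<^sup>2\<close>, and in the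
  sum over all \<open>S\<close> and \<open>N\<close> only \<open>N = - a\<close> survives, giving
  \<open>q\<close>.\<close>

lemma sum_psi_ext_kl2:
  assumes a: "a \<noteq> 0"
  shows "(\<Sum>x\<in>E - {0}. \<psi> (tr (x + to_ac a / x))) = 2 * q - (K a)\<^sup>2"
proof -
  have "(\<Sum>x\<in>E - {0}. \<psi> (tr (x + to_ac a / x))) = (\<Sum>x\<in>E - {0}. \<psi> (tr x + a * tr x / nm x))"
    by (intro sum.cong refl) (simp add: tr_add tr_divide E_closed)
  moreover have "(\<Sum>x\<in>E - {0}. \<psi> (tr x + a * tr x / nm x))
      + (\<Sum>x\<in>-{0}. \<Sum>y\<in>-{0}. \<psi> (x + y + a * (x + y) / (x * y)))
      = 2 * (\<Sum>S\<in>UNIV. \<Sum>N\<in>-{0}. \<psi> (S + a * S / N))"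
    by (rule sum_trace_norm)
  moreover have "(\<Sum>x\<in>-{0}. \<Sum>y\<in>-{0}. \<psi> (x + y + a * (x + y) / (x * y))) = (K a)\<^sup>2"
    unfolding power2_eq_square kl2_def sum_product
  proof (intro sum.cong refl)
    fix x y :: 'a assume "x \<in> -{0}" "y \<in> -{0}"
    then have "x + y + a * (x + y) / (x * y) = (x + a / x) + (y + a / y)" by (simp add: field_simps)
    then show "\<psi> (x + y + a * (x + y) / (x * y)) = \<psi> (x + a / x) * \<psi> (y + a / y)"
      by (simp only: psi_add)
  qed
  moreover have "(\<Sum>S\<in>UNIV. \<Sum>N\<in>-{0}. \<psi> (S + a * S / N)) = q"
  proof -
    have "(\<Sum>S\<in>UNIV. \<Sum>N\<in>-{0}. \<psi> (S + a * S / N)) = (\<Sum>N\<in>-{0}. \<Sum>S\<in>UNIV. \<psi> ((1 + a / N) * S))"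
      by (subst sum.swap) (simp add: algebra_simps)
    also have "\<dots> = (\<Sum>N\<in>-{0}. if N = -a then q else 0)"
    proof (intro sum.cong refl)
      fix N :: 'a assume "N \<in> -{0}"
      then have "1 + a / N = 0 \<longleftrightarrow> N = -a" by (simp add: add_divide_eq_iff eq_neg_iff_add_eq_0)
      then show "(\<Sum>S\<in>UNIV. \<psi> ((1 + a / N) * S)) = (if N = -a then q else 0)"
        by (simp add: sum_psi_scale)
    qed
    finally show ?thesis using a by simp
  qed
  ultimately show ?thesis by (simp add: eq_diff_eq)
qed

text \<open>The nonsplit counterpart of the product formula. Among the \<open>y\<close> of norm
  \<open>n\<close>, the traces of \<open>c / y\<close> and \<open>y * frob c / n\<close> agree, so
  \<open>y + c / y\<close> has the trace of \<open>y * w\<close> with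
  \<open>w = 1 + frob c / n\<close>. Multiplication by \<open>w\<close> maps this norm fiber onto
  another one, and \<open>sum_psi_norm_fiber\<close> applies.\<close>

lemma sum_psi_ext_twisted:
  assumes c: "c \<in> E" "c \<noteq> 0"
  shows "(\<Sum>y\<in>E - {0}. \<psi> (tr (y + c / y)))
    = (\<Sum>n\<in>-{0}. - K (n + tr c + nm c / n) + (if c = - to_ac n then q else 0))"
proof -
  have "(\<Sum>y\<in>E - {0}. \<psi> (tr (y + c / y))) = (\<Sum>n\<in>-{0}. \<Sum>y | y \<in> E - {0} \<and> nm y = n. \<psi> (tr (y + c / y)))"
    by (rule sum.group[symmetric]) (auto simp: nm_eq_0_iff)
  also have "\<dots> = (\<Sum>n\<in>-{0}. - K (n + tr c + nm c / n) + (if c = - to_ac n then q else 0))"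
  proof (intro sum.cong refl)
    fix n :: 'a assume "n \<in> -{0}"
    then have n: "n \<noteq> 0" by simp
    define w where "w = 1 + frob c / to_ac n"
    have wE: "w \<in> E" by (simp add: w_def c E_closed)
    have frob_w: "frob w = 1 + c / to_ac n" using c(1) by (simp add: w_def in_E_iff)
    have nmw: "n * nm w = n + tr c + nm c / n"
    proof -
      have "to_ac (n * nm w) = to_ac (n + tr c + nm c / n)"
      proof -
        have "to_ac (n * nm w) = to_ac n * ((1 + frob c / to_ac n) * (1 + c / to_ac n))"
          unfolding to_ac_mult to_ac_nm[OF wE] frob_w by (simp only: w_def)
        also have "\<dots> = to_ac n + (c + frob c) + c * frob c / to_ac n"
          using n by (intro mult_one_plus_divide) simp
        finally show ?thesis by (simp only: to_ac_add to_ac_divide to_ac_tr[OF c(1)] to_ac_nm[OF c(1)])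
      qed
      then show ?thesis by (simp only: to_ac_eq_iff)
    qed
    have w0: "w = 0 \<longleftrightarrow> c = - to_ac n"
    proof -
      have "w = 0 \<longleftrightarrow> frob w = 0" by simp
      also have "\<dots> \<longleftrightarrow> c = - to_ac n"
      proof -
        have "1 + c / to_ac n = (c + to_ac n) / to_ac n" using n by (simp add: add_divide_distrib)
        then show ?thesis unfolding frob_w using n by (simp add: eq_neg_iff_add_eq_0)
      qed
      finally show ?thesis .
    qed
    have "(\<Sum>y | y \<in> E - {0} \<and> nm y = n. \<psi> (tr (y + c / y))) = (\<Sum>y | y \<in> E - {0} \<and> nm y = n. \<psi> (tr (y * w)))"
    proof (intro sum.cong refl arg_cong[of _ _ \<psi>])
      fix y assume "y \<in> {y. y \<in> E - {0} \<and> nm y = n}"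
      then have y: "y \<in> E" "y \<noteq> 0" and nmy: "nm y = n" by auto
      have n': "to_ac n = y * frob y" using to_ac_nm[OF y(1)] by (simp only: nmy)
      have "frob (frob c) = c" using c(1) by (simp add: in_E_iff)
      then have "y * w + frob (y * w) = (y + frob c / frob y) + (frob y + c / y)"
        unfolding frob_simps(2) frob_w unfolding w_def n'
        using y by (simp only: mult_one_plus_divide_mult frob_simps simp_thms)
      also have "\<dots> = y + c / y + frob (y + c / y)"
        by (simp add: algebra_simps)
      finally show "tr (y + c / y) = tr (y * w)"
        unfolding ext_trace_2 frob_def[symmetric] by (simp only:)
    qed
    also have "\<dots> = - K (n * nm w) + (if w = 0 then q else 0)"
    proof (cases "w = 0")
      \<comment> \<open>If \<open>w = 0\<close>, all \<open>q + 1\<close> elements of the fiber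
        contribute \<open>\<psi> 0 = 1\<close>, and \<open>q + 1 = - K 0 + q\<close>.\<close>
      case True
      have "tr 0 = 0" by (rule tr_eqI) simp
      moreover have "nm w = 0" using True wE by (simp add: nm_eq_0_iff)
      ultimately show ?thesis using True card_norm_fiber[OF n] by simp
    next
      case False
      then have nw: "n * nm w \<noteq> 0" using n wE by (simp add: nm_eq_0_iff)
      have "(\<Sum>y | y \<in> E - {0} \<and> nm y = n. \<psi> (tr (y * w))) = (\<Sum>y | y \<in> E - {0} \<and> nm y = n * nm w. \<psi> (tr y))"
        using False wE n nw
        by (intro sum.reindex_bij_witness[of _ "\<lambda>y. y / w" "\<lambda>y. y * w"])
          (auto simp: E_closed nm_mult nm_div nm_eq_0_iff)
      then show ?thesis using sum_psi_norm_fiber[OF nw] False by simp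
    qed
    finally show "(\<Sum>y | y \<in> E - {0} \<and> nm y = n. \<psi> (tr (y + c / y)))
        = - K (n + tr c + nm c / n) + (if c = - to_ac n then q else 0)"
      unfolding nmw w0 .
  qed
  finally show ?thesis .
qed

text \<open>Putting \<open>t = n / c\<close> in \<open>kl2_mult\<close> makes the arguments depend
  only on \<open>c + c'\<close> and \<open>c * c'\<close>, which matches trace and norm of
  \<open>c\<close> in \<open>sum_psi_ext_twisted\<close>.\<close>

lemma kl2_mult':
  assumes "c \<noteq> 0"
  shows "K c * K c' = (\<Sum>n\<in>-{0}. K (n + (c + c') + c * c' / n)) + (if c = c' then q else 0)"
proof -
  have "(\<Sum>t\<in>-{0}. K ((1 + t) * (c + c' / t))) = (\<Sum>n\<in>-{0}. K ((1 + 1 / c * n) * (c + c' / (1 / c * n))))"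
    using assms by (intro sum_nonzero_scale[symmetric]) simp
  also have "\<dots> = (\<Sum>n\<in>-{0}. K (n + (c + c') + c * c' / n))"
    using assms by (intro sum.cong refl arg_cong[of _ _ K]) (simp add: field_simps)
  finally show ?thesis by (simp only: kl2_mult)
qed

lemma kl3_eq_sum_kl2: "K3 a = (\<Sum>x\<in>-{0}. \<psi> x * K (a / x))"
  unfolding kl3_def kl2_def
  by (intro sum.cong refl) (simp add: sum_distrib_left psi_add[symmetric] add.assoc)

text \<open>The common summand of the split and the nonsplit case, for \<open>x\<close> with trace
  \<open>S\<close> and norm \<open>N\<close>; then \<open>a / x\<close> has trace
  \<open>a * S / N\<close> and norm \<open>a\<^sup>2 / N\<close>.\<close>

definition kl3_kernel :: "'a \<Rightarrow> 'a \<Rightarrow> 'a \<Rightarrow> complex" where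
  "kl3_kernel a S N = \<psi> S * (\<Sum>n\<in>-{0}. K (n + a * S / N + a\<^sup>2 / N / n))"

text \<open>Expand \<open>K\<close> and sum over \<open>S\<close> first: only
  \<open>u = - a / N\<close> survives, which leaves a double sum over \<open>N\<close> and
  \<open>n\<close>.\<close>

lemma sum_kl3_kernel:
  assumes a: "a \<noteq> 0"
  shows "(\<Sum>S\<in>UNIV. \<Sum>N\<in>-{0}. kl3_kernel a S N) = q * K3 (- a)"
proof -
  have "(\<Sum>S\<in>UNIV. \<Sum>N\<in>-{0}. kl3_kernel a S N)
      = (\<Sum>N\<in>-{0}. \<Sum>S\<in>UNIV. \<Sum>n\<in>-{0}. \<Sum>u\<in>-{0}. \<psi> (u + (n + a\<^sup>2 / N / n) / u) * \<psi> ((1 + a / N / u) * S))"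
    unfolding kl3_kernel_def kl2_def
    by (subst sum.swap) (simp add: sum_distrib_left psi_add[symmetric] add_divide_distrib algebra_simps)
  also have "\<dots> = (\<Sum>N\<in>-{0}. \<Sum>n\<in>-{0}. \<Sum>u\<in>-{0}. \<psi> (u + (n + a\<^sup>2 / N / n) / u) * (\<Sum>S\<in>UNIV. \<psi> ((1 + a / N / u) * S)))"
    by (rule sum.cong[OF refl], subst sum.swap, rule sum.cong[OF refl], subst sum.swap)
      (simp add: sum_distrib_left)
  also have "\<dots> = (\<Sum>N\<in>-{0}. \<Sum>n\<in>-{0}. q * \<psi> (- a / N + (- (N / a) * n) - a / n))"
  proof (intro sum.cong refl)
    fix N n :: 'a assume "N \<in> -{0}" "n \<in> -{0}"
    then have N: "N \<noteq> 0" and n: "n \<noteq> 0" by auto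
    have "(\<Sum>u\<in>-{0}. \<psi> (u + (n + a\<^sup>2 / N / n) / u) * (\<Sum>S\<in>UNIV. \<psi> ((1 + a / N / u) * S)))
        = (\<Sum>u\<in>-{0}. if u = - a / N then \<psi> (u + (n + a\<^sup>2 / N / n) / u) * q else 0)"
    proof (intro sum.cong refl)
      fix u :: 'a assume "u \<in> -{0}"
      then have "1 + a / N / u = (u + a / N) / u" by (simp add: add_divide_distrib)
      then have "1 + a / N / u = 0 \<longleftrightarrow> u = - a / N"
        using \<open>u \<in> -{0}\<close> by (simp add: eq_neg_iff_add_eq_0)
      then show "\<psi> (u + (n + a\<^sup>2 / N / n) / u) * (\<Sum>S\<in>UNIV. \<psi> ((1 + a / N / u) * S))
          = (if u = - a / N then \<psi> (u + (n + a\<^sup>2 / N / n) / u) * q else 0)"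
        by (simp add: sum_psi_scale)
    qed
    also have "\<dots> = q * \<psi> (- a / N + (n + a\<^sup>2 / N / n) / (- a / N))"
      using a N by simp
    also have "- a / N + (n + a\<^sup>2 / N / n) / (- a / N) = - a / N + (- (N / a) * n) - a / n"
      using a N n by (simp add: field_simps power2_eq_square)
    finally show "(\<Sum>u\<in>-{0}. \<psi> (u + (n + a\<^sup>2 / N / n) / u) * (\<Sum>S\<in>UNIV. \<psi> ((1 + a / N / u) * S)))
        = q * \<psi> (- a / N + (- (N / a) * n) - a / n)" .
  qed
  also have "\<dots> = q * K3 (- a)"
  proof -
    \<comment> \<open>The coordinates are \<open>x = - a / N\<close> and
      \<open>y = - (N / a) * n\<close>, chosen so that \<open>x * y = n\<close>.\<close>
    have "K3 (- a) = (\<Sum>N\<in>-{0}. \<Sum>y\<in>-{0}. \<psi> (- a / N + y + - a / ((- a / N) * y)))"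
      unfolding kl3_def using a by (intro sum_nonzero_divide[symmetric]) simp
    also have "\<dots> = (\<Sum>N\<in>-{0}. \<Sum>n\<in>-{0}. \<psi> (- a / N + (- (N / a) * n) + - a / ((- a / N) * (- (N / a) * n))))"
      using a by (intro sum.cong refl sum_nonzero_scale[symmetric]) simp
    also have "\<dots> = (\<Sum>N\<in>-{0}. \<Sum>n\<in>-{0}. \<psi> (- a / N + (- (N / a) * n) - a / n))"
      using a by (intro sum.cong refl arg_cong[of _ _ \<psi>]) simp
    finally show ?thesis by (simp add: sum_distrib_left)
  qed
  finally show ?thesis .
qed

text \<open>The nonsplit sum is minus a kernel sum plus \<open>?D\<close>, and
  \<open>(K3 a)\<^sup>2\<close> is the split kernel sum plus the same \<open>?D\<close>. By
  \<open>sum_trace_norm\<close> the two kernel sums add up to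
  \<open>2 * q * K3 (- a)\<close>.\<close>

lemma sum_psi_ext_kl3:
  assumes a: "a \<noteq> 0"
  shows "(\<Sum>x\<in>E - {0}. \<Sum>y\<in>E - {0}. \<psi> (tr (x + y + to_ac a / (x * y)))) = (K3 a)\<^sup>2 - 2 * q * K3 (- a)"
proof -
  \<comment> \<open>The exceptional terms of the two product formulas: they come from
    \<open>x\<close> in the base field in the nonsplit case and from \<open>y = x\<close> in the
    split case.\<close>
  let ?D = "q * (\<Sum>s\<in>-{0}. \<psi> (2 * s))"
  have "(\<Sum>x\<in>E - {0}. \<Sum>y\<in>E - {0}. \<psi> (tr (x + y + to_ac a / (x * y))))
      = (\<Sum>x\<in>E - {0}. \<psi> (tr x) * (\<Sum>y\<in>E - {0}. \<psi> (tr (y + (to_ac a / x) / y))))"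
  proof (intro sum.cong refl)
    fix x assume x: "x \<in> E - {0}"
    have "\<psi> (tr (x + y + to_ac a / (x * y))) = \<psi> (tr x) * \<psi> (tr (y + (to_ac a / x) / y))" if "y \<in> E - {0}" for y
      using x that by (simp add: add.assoc tr_add E_closed psi_add[symmetric])
    then show "(\<Sum>y\<in>E - {0}. \<psi> (tr (x + y + to_ac a / (x * y))))
        = \<psi> (tr x) * (\<Sum>y\<in>E - {0}. \<psi> (tr (y + (to_ac a / x) / y)))"
      by (simp add: sum_distrib_left)
  qed
  also have "\<dots> = (\<Sum>x\<in>E - {0}. - kl3_kernel a (tr x) (nm x)
      + (\<Sum>n\<in>-{0}. if x = to_ac (- a / n) then q * \<psi> (tr x) else 0))"
  proof (intro sum.cong refl)
    fix x assume x: "x \<in> E - {0}"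
    have root: "to_ac a / x = - to_ac n \<longleftrightarrow> x = to_ac (- a / n)" if "n \<in> -{0}" for n
    proof -
      have "to_ac a / x = - to_ac n \<longleftrightarrow> to_ac a = - to_ac n * x"
        using x by (simp add: divide_eq_eq)
      also have "\<dots> \<longleftrightarrow> x * to_ac n = - to_ac a"
        by (subst mult_minus_left, subst equation_minus_iff) (simp only: mult.commute)
      also have "\<dots> \<longleftrightarrow> x = to_ac (- a / n)"
        using that nonzero_eq_divide_eq[of "to_ac n" x "- to_ac a"] by simp
      finally show ?thesis .
    qed
    have "(\<Sum>y\<in>E - {0}. \<psi> (tr (y + (to_ac a / x) / y)))
        = (\<Sum>n\<in>-{0}. - K (n + a * tr x / nm x + a\<^sup>2 / nm x / n) + (if x = to_ac (- a / n) then q else 0))"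
      using x a by (subst sum_psi_ext_twisted) (simp_all add: E_closed root tr_divide nm_divide)
    moreover have "\<psi> (tr x) * (if P then q else 0) = (if P then q * \<psi> (tr x) else 0)" for P
      by simp
    ultimately show "\<psi> (tr x) * (\<Sum>y\<in>E - {0}. \<psi> (tr (y + (to_ac a / x) / y)))
        = - kl3_kernel a (tr x) (nm x) + (\<Sum>n\<in>-{0}. if x = to_ac (- a / n) then q * \<psi> (tr x) else 0)"
      by (simp only: kl3_kernel_def sum.distrib sum_negf distrib_left sum_distrib_left mult_minus_right)
  qed
  also have "\<dots> = - (\<Sum>x\<in>E - {0}. kl3_kernel a (tr x) (nm x)) + ?D"
  proof -
    have "(\<Sum>x\<in>E - {0}. \<Sum>n\<in>-{0}. if x = to_ac (- a / n) then q * \<psi> (tr x) else 0)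
        = (\<Sum>n\<in>-{0}. q * \<psi> (tr (to_ac (- a / n))))"
      using a by (subst sum.swap) (intro sum.cong refl, simp add: E_closed del: to_ac_divide to_ac_minus)
    also have "\<dots> = ?D"
      unfolding tr_to_ac using a sum_nonzero_divide[of "- a" "\<lambda>s. q * \<psi> (2 * s)"]
      by (simp add: sum_distrib_left)
    finally show ?thesis by (simp only: sum.distrib sum_negf)
  qed
  finally have nonsplit: "(\<Sum>x\<in>E - {0}. \<Sum>y\<in>E - {0}. \<psi> (tr (x + y + to_ac a / (x * y)))) = \<dots>" .
  have "(K3 a)\<^sup>2 = (\<Sum>x\<in>-{0}. \<Sum>y\<in>-{0}. \<psi> (x + y) * (K (a / x) * K (a / y)))"
    unfolding power2_eq_square kl3_eq_sum_kl2 sum_product psi_add by (simp only: mult_ac)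
  also have "\<dots> = (\<Sum>x\<in>-{0}. \<Sum>y\<in>-{0}. kl3_kernel a (x + y) (x * y) + (if y = x then q * \<psi> (2 * x) else 0))"
  proof (intro sum.cong refl)
    fix x y :: 'a assume "x \<in> -{0}" "y \<in> -{0}"
    then have xy: "x \<noteq> 0" "y \<noteq> 0" by auto
    have sum_eq: "a / x + a / y = a * (x + y) / (x * y)" and prod_eq: "a / x * (a / y) = a\<^sup>2 / (x * y)"
      using xy by (simp_all add: add_same_numerator power2_eq_square)
    have eq_iff: "a / x = a / y \<longleftrightarrow> y = x" using a by auto
    have "a / x \<noteq> 0" using a xy by simp
    then have "K (a / x) * K (a / y)
        = (\<Sum>n\<in>-{0}. K (n + a * (x + y) / (x * y) + a\<^sup>2 / (x * y) / n)) + (if y = x then q else 0)"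
      by (rule kl2_mult'[of "a / x" "a / y", unfolded sum_eq prod_eq eq_iff])
    moreover have "\<psi> (x + y) * (if y = x then q else 0) = (if y = x then q * \<psi> (2 * x) else 0)"
      by (simp flip: mult_2)
    ultimately show "\<psi> (x + y) * (K (a / x) * K (a / y))
        = kl3_kernel a (x + y) (x * y) + (if y = x then q * \<psi> (2 * x) else 0)"
      by (simp only: kl3_kernel_def distrib_left)
  qed
  also have "\<dots> = (\<Sum>x\<in>-{0}. \<Sum>y\<in>-{0}. kl3_kernel a (x + y) (x * y)) + ?D"
    by (simp add: sum.distrib sum_distrib_left)
  finally have split: "(K3 a)\<^sup>2 = \<dots>" .
  have "(\<Sum>x\<in>E - {0}. kl3_kernel a (tr x) (nm x)) + (\<Sum>x\<in>-{0}. \<Sum>y\<in>-{0}. kl3_kernel a (x + y) (x * y))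
      = 2 * (q * K3 (- a))"
    unfolding sum_trace_norm sum_kl3_kernel[OF a] ..
  then show ?thesis unfolding nonsplit split by (simp add: algebra_simps)
qed

end

section \<open>Frobenius eigenvalues\<close>

lemma sum_PiE_1:
  "(\<Sum>x \<in> {1..<2::nat} \<rightarrow>\<^sub>E S. F (x 1)) = (\<Sum>u\<in>S. F u)"
proof -
  have "{1..<2::nat} = {1}" by auto
  then show ?thesis
    by (intro sum.reindex_bij_witness[of _ "\<lambda>u. restrict (\<lambda>_. u) {1}" "\<lambda>x. x 1"])
      (auto simp: PiE_iff extensional_def)
qed

lemma sum_PiE_2:
  "(\<Sum>x \<in> {1..<3::nat} \<rightarrow>\<^sub>E S. F (x 1) (x 2)) = (\<Sum>u\<in>S. \<Sum>v\<in>S. F u v)"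
proof -
  have "{1..<3::nat} = {1, 2}" by auto
  then have "(\<Sum>x \<in> {1..<3::nat} \<rightarrow>\<^sub>E S. F (x 1) (x 2)) = (\<Sum>z\<in>S \<times> S. F (fst z) (snd z))"
    by (intro sum.reindex_bij_witness[of _ "\<lambda>z. restrict (\<lambda>i. if i = 1 then fst z else snd z) {1, 2}"
          "\<lambda>x. (x 1, x 2)"])
      (auto simp: PiE_iff extensional_def fun_eq_iff)
  then show ?thesis by (simp add: sum.cartesian_product case_prod_unfold)
qed

lemma Kl_frob_trace_2:
  "Kl_frob_trace \<psi> 2 a k = - (\<Sum>x\<in>ext_field k - {0}. \<psi> (ext_trace k (x + to_ac a / x)))"
proof -
  have "{1..<2::nat} = {1}" by auto
  then show ?thesis
    unfolding Kl_frob_trace_def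
    using sum_PiE_1[where S = "ext_field k - {0}" and F = "\<lambda>x. \<psi> (ext_trace k (x + to_ac a / x))"] by simp
qed

lemma Kl_frob_trace_3:
  "Kl_frob_trace \<psi> 3 a k
    = (\<Sum>x\<in>ext_field k - {0}. \<Sum>y\<in>ext_field k - {0}. \<psi> (ext_trace k (x + y + to_ac a / (x * y))))"
proof -
  have "{1..<3::nat} = {1, 2}" by auto
  then show ?thesis
    unfolding Kl_frob_trace_def
    using sum_PiE_2[where S = "ext_field k - {0}" and F = "\<lambda>x y. \<psi> (ext_trace k (x + y + to_ac a / (x * y)))"] by simp
qed

lemma sum_ext_field_1:
  "(\<Sum>x\<in>ext_field 1 - {0}. F x) = (\<Sum>x\<in>-{0::'a::{finite,field}}. F (to_ac x))"
proof -
  have "ext_field 1 - {0} = to_ac ` (-{0::'a})" unfolding ext_field_1 by auto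
  then show ?thesis by (simp add: sum.reindex inj_on_def)
qed

lemma Kl_frob_trace_2_1: "Kl_frob_trace \<psi> 2 a 1 = - kl2 \<psi> a"
proof -
  have "Kl_frob_trace \<psi> 2 a 1 = - (\<Sum>x\<in>-{0}. \<psi> (ext_trace 1 (to_ac (x + a / x))))"
    unfolding Kl_frob_trace_2 sum_ext_field_1 by simp
  then show ?thesis by (simp only: ext_trace_1 kl2_def)
qed

lemma Kl_frob_trace_3_1: "Kl_frob_trace \<psi> 3 a 1 = kl3 \<psi> a"
proof -
  have "Kl_frob_trace \<psi> 3 a 1 = (\<Sum>x\<in>-{0}. \<Sum>y\<in>-{0}. \<psi> (ext_trace 1 (to_ac (x + y + a / (x * y)))))"
    unfolding Kl_frob_trace_3 sum_ext_field_1 by simp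
  then show ?thesis by (simp only: ext_trace_1 kl3_def)
qed

context prime_character
begin

lemma Kl_frob_trace_2_2: "a \<noteq> 0 \<Longrightarrow> Kl_frob_trace \<psi> 2 a 2 = (K a)\<^sup>2 - 2 * q"
  by (simp add: Kl_frob_trace_2 sum_psi_ext_kl2)

lemma Kl_frob_trace_3_2: "a \<noteq> 0 \<Longrightarrow> Kl_frob_trace \<psi> 3 a 2 = (K3 a)\<^sup>2 - 2 * q * K3 (- a)"
  by (simp add: Kl_frob_trace_3 sum_psi_ext_kl3)

end

section \<open>Multisets of complex numbers with given power sums\<close>

lemma prod_linear_nonzero: "(\<Prod>\<alpha>\<in>#M. [:- \<alpha>, 1 :: complex:]) \<noteq> 0"
  by (induction M) (simp_all del: mult_pCons_left)

lemma ex1_monic_roots: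
  fixes P :: "complex poly"
  assumes "Polynomial.lead_coeff P = 1"
  shows "\<exists>!M. (\<Prod>\<alpha>\<in>#M. [:- \<alpha>, 1:]) = P"
proof (rule ex1I)
  show "(\<Prod>\<alpha>\<in>#proots P. [:- \<alpha>, 1:]) = P"
    using complex_poly_decompose_multiset[of P] assms by simp
  show "M = proots P" if "(\<Prod>\<alpha>\<in>#M. [:- \<alpha>, 1:]) = P" for M
  proof -
    have "proots (\<Prod>\<alpha>\<in>#M. [:- \<alpha>, 1:]) = M"
    proof (induction M)
      case (add x M)
      have "proots ([:- x, 1:] * (\<Prod>\<alpha>\<in>#M. [:- \<alpha>, 1:])) = proots [:- x, 1:] + proots (\<Prod>\<alpha>\<in>#M. [:- \<alpha>, 1:])"
        by (rule proots_mult[OF _ prod_linear_nonzero]) simp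
      then show ?case using add by (simp del: mult_pCons_left)
    qed simp
    then show ?thesis using that by simp
  qed
qed

lemma size_2_mset:
  assumes "size M = 2"
  shows "\<exists>a b. M = {#a, b#}"
proof -
  obtain a N where N: "M = add_mset a N"
    using assms size_eq_Suc_imp_eq_union[of M 1] by (auto simp: numeral_2_eq_2)
  then have "size N = 1" using assms by simp
  then show ?thesis using N size_1_singleton_mset by blast
qed

lemma size_3_mset:
  assumes "size M = 3"
  shows "\<exists>a b c. M = {#a, b, c#}"
proof -
  obtain a N where N: "M = add_mset a N"
    using assms size_eq_Suc_imp_eq_union[of M 2] by (auto simp: numeral_3_eq_3)
  then have "size N = 2" using assms by simp
  then show ?thesis using N size_2_mset by blast
qed

lemma size_eq_degree:
  assumes "(\<Prod>\<alpha>\<in>#M. [:- \<alpha>, 1 :: complex:]) = P"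
  shows "size M = Polynomial.degree P"
proof -
  have "Polynomial.degree (\<Prod>\<alpha>\<in>#M. [:- \<alpha>, 1 :: complex:]) = size M"
  proof (induction M)
    case (add x M)
    have "Polynomial.degree ([:- x, 1:] * (\<Prod>\<alpha>\<in>#M. [:- \<alpha>, 1:]))
        = Polynomial.degree [:- x, 1:] + Polynomial.degree (\<Prod>\<alpha>\<in>#M. [:- \<alpha>, 1:])"
      by (rule degree_mult_eq[OF _ prod_linear_nonzero]) simp
    then show ?case using add by (simp del: mult_pCons_left)
  qed simp
  then show ?thesis using assms by simp
qed

text \<open>This makes the description in \<open>Kl_frob_eigenvalues\<close> denote. By Newton's
  identities the power sums amount to the coefficients of a monic polynomial, whose multiset of
  roots is unique.\<close>

lemma ex1_power_sums_2:
  fixes p :: "nat \<Rightarrow> complex"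
  shows "\<exists>!M. size M = 2 \<and> (\<forall>k\<in>{1..2}. (\<Sum>\<alpha>\<in>#M. \<alpha> ^ k) = p k)"
proof -
  define P where "P = [:((p 1)\<^sup>2 - p 2) / 2, - p 1, 1 :: complex:]"
  have set: "{1..2::nat} = {1, 2}" by auto
  have "size M = 2 \<and> (\<forall>k\<in>{1..2}. (\<Sum>\<alpha>\<in>#M. \<alpha> ^ k) = p k) \<longleftrightarrow> (\<Prod>\<alpha>\<in>#M. [:- \<alpha>, 1:]) = P" for M
  proof (cases "size M = 2")
    case True
    then obtain a b where M: "M = {#a, b#}" using size_2_mset by blast
    have "(a + b = p 1 \<and> a\<^sup>2 + b\<^sup>2 = p 2) \<longleftrightarrow> (a * b = ((p 1)\<^sup>2 - p 2) / 2 \<and> a + b = p 1)"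
    proof -
      have *: "a\<^sup>2 + b\<^sup>2 = (a + b)\<^sup>2 - 2 * (a * b)" by (simp add: power2_eq_square algebra_simps)
      have "x - 2 * y = z \<longleftrightarrow> y = (x - z) / 2" for x y z :: complex
      proof
        assume y: "y = (x - z) / 2"
        show "x - 2 * y = z" unfolding y by simp
      qed auto
      then show ?thesis unfolding * by auto
    qed
    moreover have "(\<Prod>\<alpha>\<in>#M. [:- \<alpha>, 1:]) = [:a * b, - (a + b), 1:]"
      by (simp add: M algebra_simps)
    then have "(\<Prod>\<alpha>\<in>#M. [:- \<alpha>, 1:]) = P \<longleftrightarrow> (a * b = ((p 1)\<^sup>2 - p 2) / 2 \<and> a + b = p 1)"
      by (simp only: P_def pCons_eq_iff neg_equal_iff_equal simp_thms)
    moreover have "(\<forall>k\<in>{1..2}. (\<Sum>\<alpha>\<in>#M. \<alpha> ^ k) = p k) \<longleftrightarrow> (a + b = p 1 \<and> a\<^sup>2 + b\<^sup>2 = p 2)"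
      unfolding set by (simp add: M)
    ultimately show ?thesis using True by blast
  next
    case False
    then show ?thesis using size_eq_degree[of M P] by (auto simp: P_def)
  qed
  moreover have "\<exists>!M. (\<Prod>\<alpha>\<in>#M. [:- \<alpha>, 1:]) = P"
    by (rule ex1_monic_roots) (simp add: P_def)
  ultimately show ?thesis by simp
qed

lemma ex1_power_sums_3:
  fixes p :: "nat \<Rightarrow> complex"
  shows "\<exists>!M. size M = 3 \<and> (\<forall>k\<in>{1..3}. (\<Sum>\<alpha>\<in>#M. \<alpha> ^ k) = p k)"
proof -
  \<comment> \<open>Newton's identities solved for the elementary symmetric polynomials.\<close>
  define e2 e3 where "e2 = ((p 1)\<^sup>2 - p 2) / 2" and "e3 = (p 3 - p 1 * p 2 + p 1 * e2) / 3"
  define P where "P = [:- e3, e2, - p 1, 1 :: complex:]"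
  have set: "{1..3::nat} = {1, 2, 3}" by auto
  have "size M = 3 \<and> (\<forall>k\<in>{1..3}. (\<Sum>\<alpha>\<in>#M. \<alpha> ^ k) = p k) \<longleftrightarrow> (\<Prod>\<alpha>\<in>#M. [:- \<alpha>, 1:]) = P" for M
  proof (cases "size M = 3")
    case True
    then obtain a b c where M: "M = {#a, b, c#}" using size_3_mset by blast
    have newton2: "a\<^sup>2 + b\<^sup>2 + c\<^sup>2 = (a + b + c)\<^sup>2 - 2 * (a * b + a * c + b * c)"
      by (simp add: power2_eq_square algebra_simps)
    have newton3: "a ^ 3 + b ^ 3 + c ^ 3 = (a + b + c) * (a\<^sup>2 + b\<^sup>2 + c\<^sup>2)
        - (a + b + c) * (a * b + a * c + b * c) + 3 * (a * b * c)"
      by (simp add: power2_eq_square power3_eq_cube algebra_simps)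
    have "(a + b + c = p 1 \<and> a\<^sup>2 + b\<^sup>2 + c\<^sup>2 = p 2 \<and> a ^ 3 + b ^ 3 + c ^ 3 = p 3)
        \<longleftrightarrow> (a * b * c = e3 \<and> a * b + a * c + b * c = e2 \<and> a + b + c = p 1)" (is "?L \<longleftrightarrow> ?R")
    proof
      assume ?L
      then have L: "a + b + c = p 1" "a\<^sup>2 + b\<^sup>2 + c\<^sup>2 = p 2" "a ^ 3 + b ^ 3 + c ^ 3 = p 3" by blast+
      have e2: "a * b + a * c + b * c = e2" unfolding e2_def newton2[unfolded L] by simp
      have "a * b * c = e3" unfolding e3_def newton3[unfolded L e2] by simp
      then show ?R using L e2 by simp
    next
      assume ?R
      then have R: "a + b + c = p 1" "a * b + a * c + b * c = e2" "a * b * c = e3" by blast+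
      have p2: "a\<^sup>2 + b\<^sup>2 + c\<^sup>2 = p 2" unfolding newton2[unfolded R] e2_def by simp
      have "a ^ 3 + b ^ 3 + c ^ 3 = p 3" unfolding newton3[unfolded R p2] e3_def by simp
      then show ?L using R p2 by simp
    qed
    moreover have "(\<Prod>\<alpha>\<in>#M. [:- \<alpha>, 1:]) = [:- (a * b * c), a * b + a * c + b * c, - (a + b + c), 1:]"
      by (simp add: M algebra_simps)
    then have "(\<Prod>\<alpha>\<in>#M. [:- \<alpha>, 1:]) = P
        \<longleftrightarrow> (a * b * c = e3 \<and> a * b + a * c + b * c = e2 \<and> a + b + c = p 1)"
      by (simp only: P_def pCons_eq_iff neg_equal_iff_equal simp_thms)
    moreover have "(\<forall>k\<in>{1..3}. (\<Sum>\<alpha>\<in>#M. \<alpha> ^ k) = p k)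
        \<longleftrightarrow> (a + b + c = p 1 \<and> a\<^sup>2 + b\<^sup>2 + c\<^sup>2 = p 2 \<and> a ^ 3 + b ^ 3 + c ^ 3 = p 3)"
      unfolding set by (simp add: M add.assoc)
    ultimately show ?thesis using True by blast
  next
    case False
    then show ?thesis using size_eq_degree[of M P] by (auto simp: P_def)
  qed
  moreover have "\<exists>!M. (\<Prod>\<alpha>\<in>#M. [:- \<alpha>, 1:]) = P"
    by (rule ex1_monic_roots) (simp add: P_def)
  ultimately show ?thesis by simp
qed

section \<open>Elementary and complete symmetric polynomials of few variables\<close>

lemma fps_nth_linear_mult:
  "fps_nth ((1 + fps_const (c :: complex) * fps_X) * F) n
    = fps_nth F n + (if n = 0 then 0 else c * fps_nth F (n - 1))"
  by (simp add: distrib_right mult.assoc)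

lemma elem_sym_3:
  "elem_sym 1 {#a, b, c#} = a + b + c" "elem_sym 2 {#a, b, c#} = a * b + a * c + b * c"
proof -
  have "elem_sym m {#a, b, c#} = fps_nth ((1 + fps_const a * fps_X) *
      ((1 + fps_const b * fps_X) * ((1 + fps_const c * fps_X) * 1))) m" for m
    by (simp add: elem_sym_def)
  then show "elem_sym 1 {#a, b, c#} = a + b + c" "elem_sym 2 {#a, b, c#} = a * b + a * c + b * c"
    unfolding fps_nth_linear_mult by (simp_all add: distrib_left)
qed

lemma inverse_one_minus_fps: "inverse (1 - fps_const (c :: complex) * fps_X) = Abs_fps (\<lambda>n. c ^ n)"
proof (rule fps_inverse_unique)
  show "(1 - fps_const c * fps_X) * Abs_fps (\<lambda>n. c ^ n) = 1"
  proof (rule fps_ext)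
    fix n
    have "fps_nth ((1 - fps_const c * fps_X) * Abs_fps (\<lambda>n. c ^ n)) n
        = c ^ n - (if n = 0 then 0 else c * c ^ (n - 1))"
      by (simp add: left_diff_distrib mult.assoc)
    then show "fps_nth ((1 - fps_const c * fps_X) * Abs_fps (\<lambda>n. c ^ n)) n = fps_nth 1 n"
      by (cases n) simp_all
  qed
qed

text \<open>In the sum and the product of \<open>a\<close> and \<open>b\<close> this is the
  homogenised Chebyshev polynomial of the second kind of degree 6. It is obtained by pairing the
  terms of exponents \<open>i\<close> and \<open>6 - i\<close>.\<close>

lemma complete_sym_6:
  "complete_sym 6 {#a, b#}
    = (a + b) ^ 6 - 5 * (a * b) * (a + b) ^ 4 + 6 * (a * b)\<^sup>2 * (a + b)\<^sup>2 - (a * b) ^ 3"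
proof -
  have "complete_sym 6 {#a, b#} = (\<Sum>i=0..6. a ^ i * b ^ (6 - i))"
    by (simp add: complete_sym_def inverse_one_minus_fps fps_mult_nth)
  also have "\<dots> = (a ^ 6 + b ^ 6) + (a * b) * (a ^ 4 + b ^ 4) + (a * b)\<^sup>2 * (a\<^sup>2 + b\<^sup>2) + (a * b) ^ 3"
    by (simp add: eval_nat_numeral algebra_simps)
  also have "a ^ 4 + b ^ 4 = (a\<^sup>2 + b\<^sup>2)\<^sup>2 - 2 * (a * b)\<^sup>2"
    by (simp add: power2_eq_square power_numeral_reduce algebra_simps)
  also have "a ^ 6 + b ^ 6 = (a\<^sup>2 + b\<^sup>2) ^ 3 - 3 * (a * b)\<^sup>2 * (a\<^sup>2 + b\<^sup>2)"
    by (simp add: power2_eq_square power_numeral_reduce algebra_simps)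
  also have "a\<^sup>2 + b\<^sup>2 = (a + b)\<^sup>2 - 2 * (a * b)"
    by (simp add: power2_eq_square algebra_simps)
  finally have "complete_sym 6 {#a, b#} = (s\<^sup>2 - 2 * t) ^ 3 - 3 * t\<^sup>2 * (s\<^sup>2 - 2 * t)
      + t * ((s\<^sup>2 - 2 * t)\<^sup>2 - 2 * t\<^sup>2) + t\<^sup>2 * (s\<^sup>2 - 2 * t) + t ^ 3"
    if "s = a + b" "t = a * b" for s t
    using that by simp
  also have "(s\<^sup>2 - 2 * t) ^ 3 - 3 * t\<^sup>2 * (s\<^sup>2 - 2 * t)
      + t * ((s\<^sup>2 - 2 * t)\<^sup>2 - 2 * t\<^sup>2) + t\<^sup>2 * (s\<^sup>2 - 2 * t) + t ^ 3
      = s ^ 6 - 5 * t * s ^ 4 + 6 * t\<^sup>2 * s\<^sup>2 - t ^ 3" for s t :: complex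
    by (simp add: power2_eq_square power_numeral_reduce algebra_simps)
  finally show ?thesis by blast
qed

section \<open>Symmetric functions of the Frobenius eigenvalues\<close>

context prime_character
begin

text \<open>The first two traces give the sum \<open>- K a\<close> and the product \<open>q\<close>
  of the eigenvalues; the sign of \<open>K a\<close> disappears in even powers.\<close>

lemma complete_sym_eigenvalues:
  assumes "a \<noteq> 0"
  shows "complete_sym 6 (Kl_frob_eigenvalues \<psi> 2 a)
    = (K a) ^ 6 - 5 * q * (K a) ^ 4 + 6 * q\<^sup>2 * (K a)\<^sup>2 - q ^ 3"
proof -
  define M where "M = Kl_frob_eigenvalues \<psi> 2 a"
  have M: "size M = 2 \<and> (\<forall>k\<in>{1..2}. (\<Sum>\<alpha>\<in>#M. \<alpha> ^ k) = Kl_frob_trace \<psi> 2 a k)"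
    unfolding M_def Kl_frob_eigenvalues_def by (rule theI'[OF ex1_power_sums_2])
  then obtain x y where xy: "M = {#x, y#}" using size_2_mset by blast
  have 1: "x + y = - K a" using bspec[OF conjunct2[OF M], of 1] by (simp add: xy Kl_frob_trace_2_1[simplified])
  have "x\<^sup>2 + y\<^sup>2 = (K a)\<^sup>2 - 2 * q" using bspec[OF conjunct2[OF M], of 2] by (simp add: xy Kl_frob_trace_2_2 assms)
  moreover have "(x + y)\<^sup>2 = x\<^sup>2 + y\<^sup>2 + 2 * (x * y)" by (simp add: power2_eq_square algebra_simps)
  ultimately have 2: "x * y = q" by (simp add: 1)
  show ?thesis unfolding M_def[symmetric] xy complete_sym_6 1 2 by simp
qed

lemma elem_sym_eigenvalues:
  assumes "a \<noteq> 0"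
  shows "elem_sym 1 (Kl_frob_eigenvalues \<psi> 3 a) = K3 a"
    and "elem_sym 2 (Kl_frob_eigenvalues \<psi> 3 a) = q * K3 (- a)"
proof -
  define M where "M = Kl_frob_eigenvalues \<psi> 3 a"
  have M: "size M = 3 \<and> (\<forall>k\<in>{1..3}. (\<Sum>\<alpha>\<in>#M. \<alpha> ^ k) = Kl_frob_trace \<psi> 3 a k)"
    unfolding M_def Kl_frob_eigenvalues_def by (rule theI'[OF ex1_power_sums_3])
  then obtain x y z where xyz: "M = {#x, y, z#}" using size_3_mset by blast
  have 1: "x + y + z = K3 a"
    using bspec[OF conjunct2[OF M], of 1] by (simp add: xyz Kl_frob_trace_3_1[simplified] add.assoc)
  have squares: "x\<^sup>2 + y\<^sup>2 + z\<^sup>2 = (K3 a)\<^sup>2 - 2 * q * K3 (- a)"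
    using bspec[OF conjunct2[OF M], of 2] by (simp add: xyz Kl_frob_trace_3_2 assms add.assoc)
  have "2 * (x * y + x * z + y * z) = (x + y + z)\<^sup>2 - (x\<^sup>2 + y\<^sup>2 + z\<^sup>2)"
    by (simp add: power2_eq_square algebra_simps)
  also have "\<dots> = 2 * (q * K3 (- a))" unfolding 1 squares by simp
  finally have "2 * (x * y + x * z + y * z) = 2 * (q * K3 (- a))" .
  then have 2: "x * y + x * z + y * z = q * K3 (- a)"
    by (rule mult_left_cancel[THEN iffD1, rotated]) simp
  show "elem_sym 1 (Kl_frob_eigenvalues \<psi> 3 a) = K3 a"
    "elem_sym 2 (Kl_frob_eigenvalues \<psi> 3 a) = q * K3 (- a)"
    unfolding M_def[symmetric] xyz elem_sym_3 1 2 by simp_all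
qed

end

theorem mainTheorem4:
  fixes p :: nat and \<psi> :: "'a::{finite,field} \<Rightarrow> complex"
  assumes "prime p" and "\<not> p dvd 6"
    and "CARD('a) = p"
    and "nontrivial_additive_character \<psi>"
  shows "moment_3_22 \<psi> - of_nat p ^ 3 * moment_2_6 \<psi>
           = - 2 * of_nat p ^ 6 - 2 * of_nat p ^ 4 - of_nat p ^ 2"
proof -
  interpret prime_character \<psi> "of_nat p"
    using assms by unfold_locales auto
  have char: "CHAR('a) = p" using CHAR_eq_CARD[where 'a = 'a] assms by simp
  \<comment> \<open>The characteristic is \<open>p\<close>, so \<open>p\<close> not dividing 6 says
    that 2 and 3 are nonzero in the field.\<close>
  have "(of_nat 6 :: 'a) \<noteq> 0" using assms(2) unfolding of_nat_eq_0_iff_char_dvd char .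
  then have "(2 * 3 :: 'a) \<noteq> 0" by simp
  then have two: "(2 :: 'a) \<noteq> 0" and three: "(3 :: 'a) \<noteq> 0" by (metis mult_zero_left, metis mult_zero_right)
  \<comment> \<open>With \<open>s\<^sub>2 = c * t\<close> the two terms \<open>c ^ 4 * s * t\<close>
    cancel, and the Schur polynomial becomes symmetric in \<open>s\<close> and
    \<open>t\<close>.\<close>
  have schur: "(s\<^sup>2 - c * t) * ((c * t)\<^sup>2 - c ^ 3 * s) - c ^ 3 * s * (c * t)
      = c\<^sup>2 * (s\<^sup>2 * t\<^sup>2) - c ^ 3 * (s ^ 3 + t ^ 3)" for s t c :: complex
    by (simp add: power2_eq_square power_numeral_reduce algebra_simps)
  have "moment_3_22 \<psi> = (\<Sum>a\<in>-{0}. (of_nat p)\<^sup>2 * ((K3 a)\<^sup>2 * (K3 (- a))\<^sup>2)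
      - of_nat p ^ 3 * ((K3 a) ^ 3 + (K3 (- a)) ^ 3))"
    unfolding moment_3_22_def Compl_eq_Diff_UNIV[symmetric]
  proof (rule sum.cong[OF refl])
    fix a :: 'a assume "a \<in> -{0}"
    then have a: "a \<noteq> 0" by simp
    show "(let p = of_nat CARD('a);
            s\<^sub>1 = elem_sym 1 (Kl_frob_eigenvalues \<psi> 3 a);
            s\<^sub>2 = elem_sym 2 (Kl_frob_eigenvalues \<psi> 3 a)
        in (s\<^sub>1\<^sup>2 - s\<^sub>2) * (s\<^sub>2\<^sup>2 - p ^ 3 * s\<^sub>1) - p ^ 3 * s\<^sub>1 * s\<^sub>2)
      = (of_nat p)\<^sup>2 * ((K3 a)\<^sup>2 * (K3 (- a))\<^sup>2) - of_nat p ^ 3 * ((K3 a) ^ 3 + (K3 (- a)) ^ 3)"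
      unfolding Let_def elem_sym_eigenvalues[OF a] assms(3) by (rule schur)
  qed
  moreover have "moment_2_6 \<psi> = (\<Sum>a\<in>-{0}. (K a) ^ 6 - 5 * of_nat p * (K a) ^ 4
      + 6 * (of_nat p)\<^sup>2 * (K a)\<^sup>2 - of_nat p ^ 3)"
    unfolding moment_2_6_def Compl_eq_Diff_UNIV[symmetric]
    by (intro sum.cong refl) (simp add: complete_sym_eigenvalues)
  ultimately show ?thesis using kl3_kl2_moment_identity[OF two three] by simp
qed

end
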